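(* Let $\mathbb{K}$ be a field and let $I$ be a non-equigenerated square-free monomial ideal in $R=\mathbb{K}[x_1,\ldots,x_n]$. Then $\mathrm{v}(I^{(k)})\le\mathrm{reg}(R/I^{(k)})$ for all $k\gg 0$.
   Context: $R=\mathbb{K}[x_1,\ldots,x_n]$ has its standard grading. A monomial ideal is non-equigenerated if its minimal monomial generators do not all have the same degree. The $k$-th symbolic power is $I^{(k)}=\bigcap_{P\in\mathrm{Min}(I)}(I^kR_P\cap R)$, where $\mathrm{Min}(I)=\mathrm{Ass}(R/I)$ is the set of minimal primes of the square-free monomial ideal $I$. For a proper graded ideal $J\subset R$, the v-number is $\mathrm{v}(J)=\min\{d\ge 0\mid \exists f\in R_d,\ \mathfrak{p}\in\mathrm{Ass}(J)\text{ with }(J:f)=\mathfrak{p}\}$, where $\mathrm{Ass}(J)$ is the set of associated primes of $R/J$, and $\mathrm{reg}(R/J)=\max\{j-i\mid\beta_{i,j}(R/J)\ne 0\}$ is the Castelnuovo-Mumford regularity ($\beta_{i,j}$ the graded Betti numbers). *)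

theory Defs
  imports
    "HOL-Library.Poly_Mapping"
    "HOL-Algebra.Algebra"
    "HOL-Algebra.Algebraic_Closure_Type"
    "Jordan_Normal_Form.Matrix_Kernel"
begin

section \<open>Polynomial rings and their standard grading\<close>

text \<open>The variables of the polynomial ring are indexed by a finite type; exponent vectors and
  polynomials are finitely supported functions, and the ring multiplication is convolution.\<close>

type_synonym 'n exps = "'n \<Rightarrow>\<^sub>0 nat"
type_synonym ('n, 'k) mpoly = "'n exps \<Rightarrow>\<^sub>0 'k"

abbreviation poly_ring :: "('n::finite, 'k::field) mpoly ring" where
  "poly_ring \<equiv> ring_of_type_algebra"

definition power_product :: "'n::finite exps \<Rightarrow> ('n, 'k::field) mpoly" where
  "power_product m = Poly_Mapping.single m 1"

definition mdeg :: "'n::finite exps \<Rightarrow> nat" where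
  "mdeg m = (\<Sum>x\<in>UNIV. Poly_Mapping.lookup m x)"

text \<open>The graded component in degree \<open>d\<close>; it is \<open>{0}\<close> when \<open>d\<close> is negative.\<close>

definition graded_component :: "int \<Rightarrow> ('n::finite, 'k::field) mpoly set" where
  "graded_component d = {f. \<forall>m\<in>Poly_Mapping.keys f. int (mdeg m) = d}"

text \<open>The maximal homogeneous ideal, i.e. the direct sum of the components of positive degree.\<close>

definition irrelevant_ideal :: "('n::finite, 'k::field) mpoly set" where
  "irrelevant_ideal = {f. Poly_Mapping.lookup f 0 = 0}"


section \<open>Square-free monomial ideals\<close>

definition squarefree_exps :: "'n::finite exps \<Rightarrow> bool" where
  "squarefree_exps m \<longleftrightarrow> (\<forall>x. Poly_Mapping.lookup m x \<le> 1)"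

definition squarefree_monomial_ideal :: "('n::finite, 'k::field) mpoly set \<Rightarrow> bool" where
  "squarefree_monomial_ideal I \<longleftrightarrow>
     (\<exists>S. (\<forall>m\<in>S. squarefree_exps m) \<and> I = Idl\<^bsub>poly_ring\<^esub> (power_product ` S))"

text \<open>The (exponent vectors of the) minimal monomial generators: a monomial ideal has exactly one
  monomial generating set that is minimal with respect to inclusion.\<close>

definition minimal_monomial_generating_set ::
    "('n::finite, 'k::field) mpoly set \<Rightarrow> 'n exps set \<Rightarrow> bool" where
  "minimal_monomial_generating_set I S \<longleftrightarrow>
     I = Idl\<^bsub>poly_ring\<^esub> (power_product ` S) \<and> (\<forall>T. T \<subset> S \<longrightarrow> I \<noteq> Idl\<^bsub>poly_ring\<^esub> (power_product ` T))"

definition minimal_monomial_generators :: "('n::finite, 'k::field) mpoly set \<Rightarrow> 'n exps set" where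
  "minimal_monomial_generators I = (THE S. minimal_monomial_generating_set I S)"

definition non_equigenerated :: "('n::finite, 'k::field) mpoly set \<Rightarrow> bool" where
  "non_equigenerated I \<longleftrightarrow>
     (\<exists>u\<in>minimal_monomial_generators I. \<exists>v\<in>minimal_monomial_generators I. mdeg u \<noteq> mdeg v)"


section \<open>Symbolic powers\<close>

definition minimal_primes :: "('n::finite, 'k::field) mpoly set \<Rightarrow> ('n, 'k) mpoly set set" where
  "minimal_primes I = {P. primeideal P poly_ring \<and> I \<subseteq> P \<and>
     (\<forall>Q. primeideal Q poly_ring \<longrightarrow> I \<subseteq> Q \<longrightarrow> Q \<subseteq> P \<longrightarrow> Q = P)}"

text \<open>Equality of the fractions \<open>a / s\<close> and \<open>b / t\<close> in the localization at the prime \<open>P\<close>.\<close>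

definition loc_eq :: "('n::finite, 'k::field) mpoly set
    \<Rightarrow> ('n, 'k) mpoly \<times> ('n, 'k) mpoly \<Rightarrow> ('n, 'k) mpoly \<times> ('n, 'k) mpoly \<Rightarrow> bool" where
  "loc_eq P = (\<lambda>(a, s) (b, t). \<exists>u. u \<notin> P \<and> u * (a * t - b * s) = 0)"

text \<open>The contraction to \<open>R\<close> of the extended ideal \<open>A R\<^sub>P\<close>, whose elements are the fractions
  \<open>a / s\<close> with \<open>a \<in> A\<close> and \<open>s \<notin> P\<close>.\<close>

definition localization_contraction ::
    "('n::finite, 'k::field) mpoly set \<Rightarrow> ('n, 'k) mpoly set \<Rightarrow> ('n, 'k) mpoly set" where
  "localization_contraction P A = {f. \<exists>a s. a \<in> A \<and> s \<notin> P \<and> loc_eq P (f, 1) (a, s)}"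

definition ideal_power :: "('n::finite, 'k::field) mpoly set \<Rightarrow> nat \<Rightarrow> ('n, 'k) mpoly set" where
  "ideal_power I k = ((\<lambda>A. ideal_prod poly_ring A I) ^^ k) UNIV"

definition symbolic_power :: "('n::finite, 'k::field) mpoly set \<Rightarrow> nat \<Rightarrow> ('n, 'k) mpoly set" where
  "symbolic_power I k = (\<Inter>P\<in>minimal_primes I. localization_contraction P (ideal_power I k))"


section \<open>The v-number\<close>

definition colon :: "('n::finite, 'k::field) mpoly set \<Rightarrow> ('n, 'k) mpoly \<Rightarrow> ('n, 'k) mpoly set" where
  "colon J f = {g. g * f \<in> J}"

text \<open>\<open>colon J f\<close> is the annihilator of the class of \<open>f\<close> in \<open>R / J\<close>.\<close>

definition associated_primes :: "('n::finite, 'k::field) mpoly set \<Rightarrow> ('n, 'k) mpoly set set" where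
  "associated_primes J = {P. primeideal P poly_ring \<and> (\<exists>f. P = colon J f)}"

definition v_number :: "('n::finite, 'k::field) mpoly set \<Rightarrow> nat" where
  "v_number J = (LEAST d. \<exists>f\<in>graded_component (int d). \<exists>P\<in>associated_primes J. colon J f = P)"


section \<open>Graded Betti numbers and regularity\<close>

text \<open>A sequence of graded free modules \<open>F\<^sub>i\<close> of finite rank \<open>res_rank i\<close>, whose \<open>c\<close>-th basis
  element has degree \<open>res_deg i c\<close> (so \<open>F\<^sub>i\<close> is the direct sum of the \<open>R(- res_deg i c)\<close>), with
  matrices \<open>res_map i\<close> of maps from \<open>F\<^sub>i\<^sub>+\<^sub>1\<close> to \<open>F\<^sub>i\<close>. The entries of \<open>res_aug\<close> represent the images
  of the basis elements of \<open>F\<^sub>0\<close> in \<open>R / J\<close>.\<close>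

record 'a free_complex =
  res_rank :: "nat \<Rightarrow> nat"
  res_deg :: "nat \<Rightarrow> nat \<Rightarrow> int"
  res_aug :: "'a vec"
  res_map :: "nat \<Rightarrow> 'a mat"

definition res_image :: "('n::finite, 'k::field) mpoly free_complex \<Rightarrow> nat \<Rightarrow> ('n, 'k) mpoly vec set" where
  "res_image F i = (\<lambda>v. res_map F i *\<^sub>v v) ` carrier_vec (res_rank F (Suc i))"

text \<open>Minimal graded free resolutions of \<open>R / J\<close>: all maps are homogeneous of degree 0, the
  augmented complex is exact, and the image of each \<open>F\<^sub>i\<^sub>+\<^sub>1\<close> lies in the maximal homogeneous ideal
  times \<open>F\<^sub>i\<close>.\<close>

definition minimal_free_resolution ::
    "('n::finite, 'k::field) mpoly set \<Rightarrow> ('n, 'k) mpoly free_complex \<Rightarrow> bool" where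
  "minimal_free_resolution J F \<longleftrightarrow>
     res_aug F \<in> carrier_vec (res_rank F 0) \<and>
     (\<forall>i. res_map F i \<in> carrier_mat (res_rank F i) (res_rank F (Suc i))) \<and>
     (\<forall>c < res_rank F 0. res_aug F $ c \<in> graded_component (res_deg F 0 c)) \<and>
     (\<forall>i. \<forall>r < res_rank F i. \<forall>c < res_rank F (Suc i).
        res_map F i $$ (r, c) \<in> graded_component (res_deg F (Suc i) c - res_deg F i r)) \<and>
     (\<forall>f. \<exists>v\<in>carrier_vec (res_rank F 0). f - scalar_prod (res_aug F) v \<in> J) \<and>
     {v \<in> carrier_vec (res_rank F 0). scalar_prod (res_aug F) v \<in> J} = res_image F 0 \<and>
     (\<forall>i. mat_kernel (res_map F i) = res_image F (Suc i)) \<and>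
     (\<forall>i. \<forall>r < res_rank F i. \<forall>c < res_rank F (Suc i). res_map F i $$ (r, c) \<in> irrelevant_ideal)"

text \<open>The minimal graded free resolution exists for every homogeneous ideal and is unique up to
  isomorphism of graded complexes, so ranks and degrees do not depend on the choice.\<close>

definition min_resolution :: "('n::finite, 'k::field) mpoly set \<Rightarrow> ('n, 'k) mpoly free_complex" where
  "min_resolution J = (SOME F. minimal_free_resolution J F)"

text \<open>The graded Betti numbers of \<open>R / J\<close> (not of \<open>J\<close>), and the regularity of \<open>R / J\<close>.\<close>

definition graded_betti :: "('n::finite, 'k::field) mpoly set \<Rightarrow> nat \<Rightarrow> int \<Rightarrow> nat" where
  "graded_betti J i j =
     card {c. c < res_rank (min_resolution J) i \<and> res_deg (min_resolution J) i c = j}"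

definition regularity_quotient :: "('n::finite, 'k::field) mpoly set \<Rightarrow> int" where
  "regularity_quotient J = Max {j - int i | i j. graded_betti J i j \<noteq> 0}"

end

theory Submission
  imports Defs
begin

text \<open>For square-free \<open>I\<close> the ideal \<open>I\<^sup>(\<^sup>k\<^sup>)\<close> is spanned by the monomials whose degree in the variables of
  every minimal vertex cover of \<open>I\<close> is at least \<open>k\<close>. Let \<open>w\<close> and \<open>u\<close> be minimal generators of \<open>I\<close> with
  \<open>deg w < deg u\<close>. For a minimal cover \<open>A\<close> meeting the support of \<open>w\<close> in a single variable \<open>x\<close>, the
  monomial \<open>(w\<^sup>k / x) \<Prod>\<^sub>y\<^sub>\<notin>\<^sub>A y\<close> has the prime generated by \<open>A\<close> as its colon ideal, so the v-number is at
  most \<open>k deg w + n\<close>. On the other side \<open>u\<^sup>k\<close> is a minimal generator of \<open>I\<^sup>(\<^sup>k\<^sup>)\<close>, so the regularity of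
  \<open>R / I\<^sup>(\<^sup>k\<^sup>)\<close> is at least \<open>k deg u - 1\<close>, which is larger once \<open>k > n\<close>. For the regularity to be a
  meaningful maximum one needs that a minimal free resolution exists and that every minimal free
  resolution is finite. Existence comes from the fine grading: the kernel of a finely graded matrix is
  generated in degrees below the join of the column degrees.\<close>

text \<open>The two sides are of unequal difficulty. An upper bound for a \<open>LEAST\<close> needs
  a single witness, whereas \<open>regularity_quotient\<close> is a \<open>Max\<close> over a
  resolution picked by \<open>SOME\<close>; the degree of a generator and the vanishing of high
  ranks are therefore proved for an arbitrary minimal resolution. The fine grading takes the part of
  a Noetherian argument: in one multidegree each coordinate of a vector has room for a single
  monomial, so homogeneous parts are finite-dimensional, and a bound on the multidegrees that matter
  turns this into finite generation. Total degrees are restored only when the resolution is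
  assembled. Finiteness of a minimal resolution comes from setting the variables to zero one at a
  time. Each variable uses up one homological degree of exactness, and once all are zero the maps of
  a minimal resolution vanish, which contradicts exactness unless the rank is zero.
  Non-equigeneration enters only in the final comparison: the gap between \<open>k * mdeg w\<close>
  and \<open>k * mdeg u\<close> grows with \<open>k\<close>, while the error terms \<open>n\<close>
  and \<open>1\<close> stay fixed.\<close>

no_notation fps_nth (infixl \<open>$\<close> 75)

section \<open>Exponents and supports of products\<close>

abbreviation lookup where "lookup \<equiv> Poly_Mapping.lookup"
abbreviation keys where "keys \<equiv> Poly_Mapping.keys"
abbreviation single where "single \<equiv> Poly_Mapping.single"

text \<open>One operation with two uses: projection to a multigraded component, and substitution of
  zero for a set of variables.\<close>

definition restrict_keys :: "('a \<Rightarrow> bool) \<Rightarrow> ('a \<Rightarrow>\<^sub>0 'b::zero) \<Rightarrow> 'a \<Rightarrow>\<^sub>0 'b" where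
  "restrict_keys P f = Abs_poly_mapping (\<lambda>m. if P m then lookup f m else 0)"

lemma lookup_restrict_keys: "lookup (restrict_keys P f) m = (if P m then lookup f m else 0)"
proof -
  have "finite {m. (if P m then lookup f m else 0) \<noteq> 0}"
    by (rule finite_subset[OF _ finite_lookup[of f]]) (force split: if_split_asm)
  then show ?thesis by (simp add: restrict_keys_def)
qed

lemma keys_restrict_keys: "keys (restrict_keys P f) = {m\<in>keys f. P m}"
  by (auto simp: in_keys_iff lookup_restrict_keys split: if_splits)

lemma restrict_keys_add:
  fixes f :: "'a \<Rightarrow>\<^sub>0 'b::monoid_add"
  shows "restrict_keys P (f + g) = restrict_keys P f + restrict_keys P g"
  by (rule poly_mapping_eqI) (simp add: lookup_restrict_keys lookup_add)

lemma restrict_keys_zero [simp]: "restrict_keys P 0 = 0"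
  by (rule poly_mapping_eqI) (simp add: lookup_restrict_keys)

lemma restrict_keys_id: "(\<And>m. m \<in> keys f \<Longrightarrow> P m) \<Longrightarrow> restrict_keys P f = f"
  by (rule poly_mapping_eqI) (auto simp add: lookup_restrict_keys in_keys_iff)

lemma restrict_keys_eq_0: "(\<And>m. m \<in> keys f \<Longrightarrow> \<not> P m) \<Longrightarrow> restrict_keys P f = 0"
  by (rule poly_mapping_eqI) (auto simp add: lookup_restrict_keys in_keys_iff)

lemma restrict_keys_split:
  fixes f :: "'a \<Rightarrow>\<^sub>0 'b::monoid_add"
  shows "f = restrict_keys P f + restrict_keys (\<lambda>m. \<not> P m) f"
  by (rule poly_mapping_eqI) (simp add: lookup_restrict_keys lookup_add)

lemma keys_multD: "m \<in> keys (f * g) \<Longrightarrow> \<exists>p\<in>keys f. \<exists>q\<in>keys g. m = p + q"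
  using keys_mult[of f g] by blast

text \<open>Splitting \<open>g\<close> by \<open>Q\<close> splits the product by \<open>P\<close>,
  because the exponents of \<open>f\<close> never decide on which side a term falls.\<close>

lemma restrict_keys_mult:
  fixes f g :: "'a::monoid_add \<Rightarrow>\<^sub>0 'b::semiring_0"
  assumes "\<And>p q. p \<in> keys f \<Longrightarrow> q \<in> keys g \<Longrightarrow> P (p + q) \<longleftrightarrow> Q q"
  shows "restrict_keys P (f * g) = f * restrict_keys Q g"
proof -
  have "f * g = f * restrict_keys Q g + f * restrict_keys (\<lambda>m. \<not> Q m) g"
    by (subst restrict_keys_split[of g Q]) (rule distrib_left)
  then have "restrict_keys P (f * g) =
      restrict_keys P (f * restrict_keys Q g) + restrict_keys P (f * restrict_keys (\<lambda>m. \<not> Q m) g)"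
    by (simp add: restrict_keys_add)
  moreover have "restrict_keys P (f * restrict_keys Q g) = f * restrict_keys Q g"
    by (rule restrict_keys_id) (use assms in \<open>auto dest!: keys_multD simp: keys_restrict_keys\<close>)
  moreover have "restrict_keys P (f * restrict_keys (\<lambda>m. \<not> Q m) g) = 0"
    by (rule restrict_keys_eq_0) (use assms in \<open>auto dest!: keys_multD simp: keys_restrict_keys\<close>)
  ultimately show ?thesis by simp
qed

lemma poly_mapping_sum_singles:
  fixes f :: "'a \<Rightarrow>\<^sub>0 'b::comm_monoid_add"
  shows "f = (\<Sum>m\<in>keys f. single m (lookup f m))"
proof (rule poly_mapping_eqI)
  fix k
  have "(\<Sum>m\<in>keys f. lookup (single m (lookup f m)) k) = (\<Sum>m\<in>keys f. if m = k then lookup f m else 0)"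
    by (rule sum.cong) (auto simp: lookup_single when_def)
  also have "\<dots> = lookup f k" by (auto simp: in_keys_iff)
  finally show "lookup f k = lookup (\<Sum>m\<in>keys f. single m (lookup f m)) k"
    by (simp add: lookup_sum)
qed

lemma poly_mapping_induct_single:
  fixes f :: "'a \<Rightarrow>\<^sub>0 'b::comm_monoid_add"
  assumes "P 0" and "\<And>m. m \<in> keys f \<Longrightarrow> P (single m (lookup f m))"
    and "\<And>g h. P g \<Longrightarrow> P h \<Longrightarrow> P (g + h)"
  shows "P f"
proof -
  have "P (\<Sum>m\<in>M. single m (lookup f m))" if "finite M" "M \<subseteq> keys f" for M
    using that by (induction M rule: finite_induct) (use assms in auto)
  from this[OF finite_keys order_refl] show ?thesis by (subst poly_mapping_sum_singles)
qed

text \<open>Only one pair of exponents can contribute at \<open>p + q\<close>, so nothing cancels.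
  Neither \<open>p\<close> nor \<open>q\<close> has to be a key: if one is not, both sides are
  zero.\<close>

lemma lookup_mult_unique:
  fixes f g :: "'a::comm_monoid_add \<Rightarrow>\<^sub>0 'b::comm_semiring_0"
  assumes uniq: "\<And>p' q'. p' \<in> keys f \<Longrightarrow> q' \<in> keys g \<Longrightarrow> p' + q' = p + q \<Longrightarrow> p' = p \<and> q' = q"
  shows "lookup (f * g) (p + q) = lookup f p * lookup g q"
proof -
  have "f * g = (\<Sum>m\<in>keys f. single m (lookup f m)) * (\<Sum>m\<in>keys g. single m (lookup g m))"
    using poly_mapping_sum_singles[of f] poly_mapping_sum_singles[of g] by simp
  also have "\<dots> = (\<Sum>(a,b)\<in>keys f \<times> keys g. single (a + b) (lookup f a * lookup g b))"
    by (simp add: sum_product sum.cartesian_product mult_single)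
  finally have "lookup (f * g) (p + q)
      = (\<Sum>(a,b)\<in>keys f \<times> keys g. lookup (single (a + b) (lookup f a * lookup g b)) (p + q))"
    by (simp add: lookup_sum case_prod_unfold)
  also have "\<dots> = (\<Sum>ab\<in>keys f \<times> keys g. if ab = (p, q) then lookup f p * lookup g q else 0)"
    by (rule sum.cong) (use uniq in \<open>auto simp: lookup_single when_def split: if_splits\<close>)
  also have "\<dots> = lookup f p * lookup g q"
    by (subst sum.delta) (auto simp: in_keys_iff)
  finally show ?thesis .
qed

lemma lookup_single_mult:
  fixes f :: "'a::cancel_comm_monoid_add \<Rightarrow>\<^sub>0 'b::comm_semiring_0"
  shows "lookup (single m c * f) (m + q) = c * lookup f q"
  by (subst lookup_mult_unique) (auto split: if_splits)

lemma single_mult_eq_0_iff: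
  fixes f :: "'a::cancel_comm_monoid_add \<Rightarrow>\<^sub>0 'b::comm_semiring_1"
  shows "single m 1 * f = 0 \<longleftrightarrow> f = 0"
proof
  assume "single m 1 * f = 0"
  then have "lookup f q = 0" for q using lookup_single_mult[of m 1 f q] by simp
  then show "f = 0" by (intro poly_mapping_eqI) simp
qed simp

lemma keys_single_mult:
  fixes f :: "'a::cancel_comm_monoid_add \<Rightarrow>\<^sub>0 'b::comm_semiring_1"
  shows "keys (single m 1 * f) = (+) m ` keys f"
proof (rule Set.set_eqI, rule iffI)
  fix p assume p: "p \<in> keys (single m 1 * f)"
  then obtain q where "p = m + q" using keys_multD by (metis Poly_Mapping.keys_single empty_iff singletonD)
  with p show "p \<in> (+) m ` keys f" by (simp add: in_keys_iff lookup_single_mult)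
qed (auto simp: in_keys_iff lookup_single_mult)

lemma keys_sum_subset: "keys (sum f M) \<subseteq> (\<Union>i\<in>M. keys (f i))"
proof (induction M rule: infinite_finite_induct)
  case (insert x F)
  then show ?case using keys_add[of "f x" "sum f F"] by auto
qed auto

lemma finite_exps_le: "finite {b :: 'n::finite exps. \<forall>x. lookup b x \<le> lookup c x}"
proof -
  have "lookup ` {b. \<forall>x. lookup b x \<le> lookup c x} \<subseteq> Pi\<^sub>E UNIV (\<lambda>x. {..lookup c x})" by auto
  moreover have "finite (Pi\<^sub>E (UNIV :: 'n set) (\<lambda>x. {..lookup c x}))" by (intro finite_PiE) auto
  ultimately have "finite (lookup ` {b. \<forall>x. lookup b x \<le> lookup c x})" by (rule finite_subset)
  then show ?thesis by (rule finite_imageD) (auto intro!: inj_onI poly_mapping_eqI)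
qed

lemma exps_le_imp_add:
  fixes a b :: "'n::finite exps"
  assumes "\<And>x. lookup a x \<le> lookup b x"
  shows "a + (b - a) = b"
  by (rule poly_mapping_eqI) (use assms in \<open>simp add: lookup_add lookup_minus\<close>)

text \<open>One weight for several purposes: \<open>UNIV\<close> gives the standard degree,
  singletons recover the exponents, and a vertex cover gives the order along the prime generated by
  its variables.\<close>

definition degree_in :: "'n::finite set \<Rightarrow> 'n exps \<Rightarrow> nat" where
  "degree_in A m = (\<Sum>x\<in>A. lookup m x)"

lemma degree_in_add [simp]: "degree_in A (p + q) = degree_in A p + degree_in A q"
  by (simp add: degree_in_def lookup_add sum.distrib)

lemma degree_in_0 [simp]: "degree_in A 0 = 0"
  by (simp add: degree_in_def)

lemma mdeg_eq: "mdeg = degree_in UNIV"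
  by (auto simp: mdeg_def degree_in_def)

lemma degree_in_single: "degree_in A (single x n) = (if x \<in> A then n else 0)"
  by (simp add: degree_in_def lookup_single when_def)

lemma degree_in_mono: "A \<subseteq> B \<Longrightarrow> degree_in A m \<le> degree_in B m"
  by (simp add: degree_in_def sum_mono2)

lemma degree_in_pos_iff: "degree_in A m > 0 \<longleftrightarrow> (\<exists>x\<in>A. lookup m x > 0)"
  unfolding degree_in_def neq0_conv[symmetric] by (subst sum_eq_0_iff) auto

lemma lookup_eq_degree_in: "lookup m x = degree_in {x} m"
  by (simp add: degree_in_def)

text \<open>Refining by one additive functional after the other isolates a pair of exponents
  whose sum arises only once.\<close>

lemma extremal_pair_exists:
  fixes M Y :: "'n::finite exps set"
  assumes "finite M" "finite Y" "M \<noteq> {}" "Y \<noteq> {}"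
  shows "\<exists>p\<in>M. \<exists>q\<in>Y. \<forall>p'\<in>M. \<forall>q'\<in>Y. p' + q' = p + q \<longrightarrow>
     (\<forall>B\<in>set Bs. degree_in B p' = degree_in B p \<and> degree_in B q' = degree_in B q)"
  using assms
proof (induction Bs arbitrary: M Y)
  case Nil
  then obtain p q where "p \<in> M" "q \<in> Y" by blast
  then show ?case by (metis empty_iff list.set(1))
next
  case (Cons B Bs)
  define a where "a = Min (degree_in B ` M)"
  define b where "b = Min (degree_in B ` Y)"
  define M' where "M' = {p\<in>M. degree_in B p = a}"
  define Y' where "Y' = {p\<in>Y. degree_in B p = b}"
  have min: "p \<in> M \<Longrightarrow> a \<le> degree_in B p" "p \<in> Y \<Longrightarrow> b \<le> degree_in B p" for p
    using Cons.prems by (auto simp: a_def b_def)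
  have "a \<in> degree_in B ` M" "b \<in> degree_in B ` Y"
    using Cons.prems unfolding a_def b_def by (intro Min_in; simp)+
  then have "M' \<noteq> {}" "Y' \<noteq> {}" by (auto simp: M'_def Y'_def)
  moreover have "finite M'" "finite Y'" using Cons.prems by (auto simp: M'_def Y'_def)
  ultimately have "\<exists>p\<in>M'. \<exists>q\<in>Y'. \<forall>p'\<in>M'. \<forall>q'\<in>Y'. p' + q' = p + q \<longrightarrow>
     (\<forall>B\<in>set Bs. degree_in B p' = degree_in B p \<and> degree_in B q' = degree_in B q)"
    by (intro Cons.IH)
  then obtain p q where pq: "p \<in> M'" "q \<in> Y'" and *: "\<forall>p'\<in>M'. \<forall>q'\<in>Y'. p' + q' = p + q \<longrightarrow>
     (\<forall>B\<in>set Bs. degree_in B p' = degree_in B p \<and> degree_in B q' = degree_in B q)"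
    by (elim bexE)
  show ?case
  proof (rule bexI[of _ p], rule bexI[of _ q], intro ballI impI)
    fix p' q' C assume p': "p' \<in> M" "q' \<in> Y" "p' + q' = p + q" and C: "C \<in> set (B # Bs)"
    have "degree_in B p' + degree_in B q' = a + b"
      using pq arg_cong[OF p'(3), of "degree_in B"] by (simp add: M'_def Y'_def)
    \<comment> \<open>Neither summand can fall below its minimum, and the sum of the minima is
      reached, so both are attained.\<close>
    then have "degree_in B p' = a" "degree_in B q' = b" using min(1)[OF p'(1)] min(2)[OF p'(2)] by auto
    then have "p' \<in> M'" "q' \<in> Y'" using p'(1,2) by (simp_all add: M'_def Y'_def)
    show "degree_in C p' = degree_in C p \<and> degree_in C q' = degree_in C q"
    proof (cases "C = B")
      case True
      then show ?thesis using pq \<open>degree_in B p' = a\<close> \<open>degree_in B q' = b\<close> by (simp add: M'_def Y'_def)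
    next
      case False
      then have "C \<in> set Bs" using C by simp
      then show ?thesis by (rule *[rule_format, OF \<open>p' \<in> M'\<close> \<open>q' \<in> Y'\<close> p'(3)])
    qed
  qed (use pq in \<open>simp_all add: M'_def Y'_def\<close>)
qed

text \<open>Among the terms of least weight in \<open>f\<close> and \<open>g\<close> there is a pair
  whose sum arises only once and hence survives in the product. In effect the weight is a valuation,
  which replaces a monomial order in the proofs about primes.\<close>

lemma degree_in_keys_mult:
  fixes f g :: "('n::finite, 'k::field) mpoly"
  assumes "p \<in> keys f" "q \<in> keys g"
  shows "\<exists>m\<in>keys (f * g). degree_in A m \<le> degree_in A p + degree_in A q"
proof -
  \<comment> \<open>Refining by all singletons makes the extremal pair unique, since agreement in
    every single variable is equality.\<close>
  obtain xs :: "'n set list" where xs: "set xs = (\<lambda>x. {x}) ` UNIV"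
    using finite_list[of "(\<lambda>x. {x}) ` (UNIV :: 'n set)"] by auto
  define a where "a = Min (degree_in A ` keys f)"
  define b where "b = Min (degree_in A ` keys g)"
  define M where "M = {p\<in>keys f. degree_in A p = a}"
  define Y where "Y = {p\<in>keys g. degree_in A p = b}"
  have min: "p \<in> keys f \<Longrightarrow> a \<le> degree_in A p" "p \<in> keys g \<Longrightarrow> b \<le> degree_in A p" for p
    by (auto simp: a_def b_def)
  have "a \<in> degree_in A ` keys f" "b \<in> degree_in A ` keys g"
    using assms unfolding a_def b_def by (intro Min_in; force)+
  then have "M \<noteq> {}" "Y \<noteq> {}" by (auto simp: M_def Y_def)
  moreover have "finite M" "finite Y" by (auto simp: M_def Y_def)
  ultimately obtain p0 q0 where pq: "p0 \<in> M" "q0 \<in> Y" and *: "\<forall>p'\<in>M. \<forall>q'\<in>Y. p' + q' = p0 + q0 \<longrightarrow>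
     (\<forall>B\<in>set xs. degree_in B p' = degree_in B p0 \<and> degree_in B q' = degree_in B q0)"
    by (elim bexE[OF extremal_pair_exists[of M Y xs]] bexE)
  have "lookup (f * g) (p0 + q0) = lookup f p0 * lookup g q0"
  proof (rule lookup_mult_unique)
    fix p' q' assume p': "p' \<in> keys f" "q' \<in> keys g" "p' + q' = p0 + q0"
    have "degree_in A p' + degree_in A q' = a + b"
      using pq arg_cong[OF p'(3), of "degree_in A"] by (simp add: M_def Y_def)
    then have "degree_in A p' = a" "degree_in A q' = b" using min(1)[OF p'(1)] min(2)[OF p'(2)] by auto
    then have "p' \<in> M" "q' \<in> Y" using p'(1,2) by (simp_all add: M_def Y_def)
    then have "lookup p' x = lookup p0 x \<and> lookup q' x = lookup q0 x" for x
      unfolding lookup_eq_degree_in by (rule *[rule_format, OF _ _ p'(3)]) (simp add: xs)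
    then show "p' = p0 \<and> q' = q0" by (auto intro!: poly_mapping_eqI)
  qed
  then have "p0 + q0 \<in> keys (f * g)" using pq by (auto simp: in_keys_iff M_def Y_def)
  moreover have "degree_in A (p0 + q0) \<le> degree_in A p + degree_in A q"
    using pq min(1)[OF assms(1)] min(2)[OF assms(2)] by (auto simp: M_def Y_def)
  ultimately show ?thesis by blast
qed

section \<open>Finely graded submodules of free modules\<close>

text \<open>Basis element \<open>i\<close> carries multidegree \<open>D i\<close>. By cancellation
  of exponents, each coordinate of a homogeneous vector has at most one term.\<close>

definition hom_vec :: "nat \<Rightarrow> (nat \<Rightarrow> 'n::finite exps) \<Rightarrow> 'n exps \<Rightarrow> ('n, 'k::field) mpoly vec \<Rightarrow> bool" where
  "hom_vec r D b v \<longleftrightarrow> v \<in> carrier_vec r \<and> (\<forall>i<r. \<forall>m\<in>keys (v $ i). m + D i = b)"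

definition component :: "(nat \<Rightarrow> 'n::finite exps) \<Rightarrow> 'n exps \<Rightarrow> ('n, 'k::field) mpoly vec \<Rightarrow> ('n, 'k) mpoly vec" where
  "component D b v = vec (dim_vec v) (\<lambda>i. restrict_keys (\<lambda>m. m + D i = b) (v $ i))"

definition vec_submodule :: "nat \<Rightarrow> 'a::comm_ring_1 vec set \<Rightarrow> bool" where
  "vec_submodule r N \<longleftrightarrow> N \<subseteq> carrier_vec r \<and> 0\<^sub>v r \<in> N \<and> (\<forall>u\<in>N. \<forall>v\<in>N. u + v \<in> N) \<and> (\<forall>f. \<forall>v\<in>N. f \<cdot>\<^sub>v v \<in> N)"

text \<open>For finite \<open>B\<close> this plays the part of a Noetherian condition: generators
  need to be sought in finitely many multidegrees only.\<close>

definition reducible_to_degrees ::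
    "nat \<Rightarrow> (nat \<Rightarrow> 'n::finite exps) \<Rightarrow> ('n, 'k::field) mpoly vec set \<Rightarrow> 'n exps set \<Rightarrow> bool" where
  "reducible_to_degrees r D N B \<longleftrightarrow> (\<forall>b. \<forall>v\<in>N. hom_vec r D b v \<longrightarrow>
     (\<exists>b'\<in>B. \<exists>m. \<exists>v'\<in>N. hom_vec r D b' v' \<and> v = single m 1 \<cdot>\<^sub>v v'))"

definition fine_submodule :: "nat \<Rightarrow> (nat \<Rightarrow> 'n::finite exps) \<Rightarrow> ('n, 'k::field) mpoly vec set \<Rightarrow> bool" where
  "fine_submodule r D N \<longleftrightarrow> vec_submodule r N \<and> (\<forall>b. \<forall>v\<in>N. component D b v \<in> N) \<and>
     (\<exists>B. finite B \<and> reducible_to_degrees r D N B)"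

lemma vec_submoduleD:
  assumes "vec_submodule r N"
  shows "N \<subseteq> carrier_vec r" "0\<^sub>v r \<in> N" "u \<in> N \<Longrightarrow> v \<in> N \<Longrightarrow> u + v \<in> N" "v \<in> N \<Longrightarrow> f \<cdot>\<^sub>v v \<in> N"
  using assms by (simp_all add: vec_submodule_def)

section \<open>Spans of vectors over a commutative ring\<close>

inductive_set module_span :: "nat \<Rightarrow> 'a::comm_ring_1 vec set \<Rightarrow> 'a vec set"
  for r :: nat and G :: "'a vec set" where
  zero: "0\<^sub>v r \<in> module_span r G"
| add: "g \<in> G \<Longrightarrow> v \<in> module_span r G \<Longrightarrow> f \<cdot>\<^sub>v g + v \<in> module_span r G"

lemma module_span_carrier:
  assumes "G \<subseteq> carrier_vec r" "v \<in> module_span r G"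
  shows "v \<in> carrier_vec r"
  using assms(2) by induction (use assms(1) in auto)

lemma module_span_mono:
  assumes "G \<subseteq> H" shows "module_span r G \<subseteq> module_span r H"
proof
  fix v assume "v \<in> module_span r G"
  then show "v \<in> module_span r H" by induction (use assms in \<open>auto intro: module_span.intros\<close>)
qed

lemma module_span_base: "g \<in> G \<Longrightarrow> g \<in> carrier_vec r \<Longrightarrow> f \<cdot>\<^sub>v g \<in> module_span r G"
  using module_span.add[OF _ module_span.zero, of g G f r] by simp

lemma module_span_add:
  assumes G: "G \<subseteq> carrier_vec r" and "u \<in> module_span r G" "v \<in> module_span r G"
  shows "u + v \<in> module_span r G"
  using assms(2)
proof induction
  case zero
  then show ?case using assms(3) module_span_carrier[OF G] by simp
next
  case (add g w f)
  have "f \<cdot>\<^sub>v g + w + v = f \<cdot>\<^sub>v g + (w + v)"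
    by (rule assoc_add_vec[of _ r]) (use add.hyps G assms(3) module_span_carrier[OF G] in auto)
  then show ?case using module_span.add[OF add.hyps(1) add.IH] by simp
qed

lemma module_span_smult:
  assumes G: "G \<subseteq> carrier_vec r" and "v \<in> module_span r G"
  shows "f \<cdot>\<^sub>v v \<in> module_span r G"
  using assms(2)
proof induction
  case zero
  have "f \<cdot>\<^sub>v 0\<^sub>v r = 0\<^sub>v r" by (rule eq_vecI) auto
  then show ?case using module_span.zero[of r G] by simp
next
  case (add g w h)
  have "f \<cdot>\<^sub>v (h \<cdot>\<^sub>v g + w) = (f * h) \<cdot>\<^sub>v g + f \<cdot>\<^sub>v w"
    by (subst smult_add_distrib_vec[of _ r])
      (use add.hyps G module_span_carrier[OF G] in \<open>auto simp: smult_smult_assoc\<close>)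
  then show ?case using module_span.add[OF add.hyps(1) add.IH] by simp
qed

lemma module_span_subset:
  assumes "G \<subseteq> N" "vec_submodule r N"
  shows "module_span r G \<subseteq> N"
proof
  fix v assume "v \<in> module_span r G"
  then show "v \<in> N" proof induction
    case zero
    show ?case by (rule vec_submoduleD(2)[OF assms(2)])
  next
    case (add g w f)
    then show ?case using assms(1) by (intro vec_submoduleD(3,4)[OF assms(2)]) auto
  qed
qed

lemma mult_mat_vec_smult:
  fixes M :: "'a::comm_ring_1 mat"
  assumes "M \<in> carrier_mat r s" "v \<in> carrier_vec s"
  shows "M *\<^sub>v (f \<cdot>\<^sub>v v) = f \<cdot>\<^sub>v (M *\<^sub>v v)"
  by (rule eq_vecI) (use assms in auto)

lemma mult_mat_vec_unit_vec:
  fixes M :: "'a::comm_ring_1 mat"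
  assumes "M \<in> carrier_mat r s" "j < s"
  shows "M *\<^sub>v unit_vec s j = col M j"
  by (rule eq_vecI) (use assms in auto)

text \<open>Restricting the span to columns with nonzero coefficient matters in
  \<open>minimal_presentation\<close>, where a generator has to be expressed without using
  itself.\<close>

lemma mult_mat_vec_in_span:
  fixes M :: "'a::comm_ring_1 mat"
  assumes M: "M \<in> carrier_mat r s" and h: "h \<in> carrier_vec s"
  shows "M *\<^sub>v h \<in> module_span r {col M j | j. j < s \<and> h $ j \<noteq> 0}"
proof -
  \<comment> \<open>The induction is on \<open>t\<close>, a bound beyond which all coefficients of
    \<open>h\<close> vanish.\<close>
  have "M *\<^sub>v h \<in> module_span r {col M j | j. j < s \<and> h $ j \<noteq> 0}"
    if "h \<in> carrier_vec s" "\<And>j. t \<le> j \<Longrightarrow> j < s \<Longrightarrow> h $ j = 0" for t h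
    using that
  proof (induction t arbitrary: h)
    case 0
    then have "h = 0\<^sub>v s" by (intro eq_vecI) auto
    then have "M *\<^sub>v h = 0\<^sub>v r" using M by (intro eq_vecI) auto
    then show ?case by (simp add: module_span.zero)
  next
    case (Suc t)
    show ?case
    proof (cases "t < s \<and> h $ t \<noteq> 0")
      case False
      have "h $ j = 0" if "t \<le> j" "j < s" for j
        using that False Suc.prems(2)[of j] by (cases "j = t") auto
      then show ?thesis using Suc.IH Suc.prems(1) by blast
    next
      case True
      define h' where "h' = vec s (\<lambda>j. if j = t then 0 else h $ j)"
      have h': "h' \<in> carrier_vec s" by (simp add: h'_def)
      have sub: "{col M j | j. j < s \<and> h' $ j \<noteq> 0} \<subseteq> {col M j | j. j < s \<and> h $ j \<noteq> 0}"
        by (auto simp: h'_def split: if_splits)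
      have "M *\<^sub>v h' \<in> module_span r {col M j | j. j < s \<and> h' $ j \<noteq> 0}"
        by (rule Suc.IH) (use Suc.prems in \<open>auto simp: h'_def\<close>)
      then have *: "M *\<^sub>v h' \<in> module_span r {col M j | j. j < s \<and> h $ j \<noteq> 0}"
        using module_span_mono[OF sub] by blast
      have "h = h $ t \<cdot>\<^sub>v unit_vec s t + h'"
        by (rule eq_vecI) (use True Suc.prems in \<open>auto simp: h'_def\<close>)
      then have "M *\<^sub>v h = M *\<^sub>v (h $ t \<cdot>\<^sub>v unit_vec s t + h')" by simp
      also have "\<dots> = h $ t \<cdot>\<^sub>v col M t + M *\<^sub>v h'"
        using True by (simp add: mult_add_distrib_mat_vec[OF M _ h'] mult_mat_vec_smult[OF M]
          mult_mat_vec_unit_vec[OF M])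
      also have "\<dots> \<in> module_span r {col M j | j. j < s \<and> h $ j \<noteq> 0}"
        by (rule module_span.add[OF _ *]) (use True in auto)
      finally show ?thesis .
    qed
  qed
  from this[OF h, of s] show ?thesis by simp
qed

lemma keys_subset_singleton:
  assumes "keys f \<subseteq> {m}" shows "f = single m (lookup f m)"
  by (rule poly_mapping_eqI) (use assms in \<open>auto simp: lookup_single when_def in_keys_iff\<close>)

text \<open>In a fixed multidegree every coordinate is a scalar times one fixed monomial, so
  \<open>W\<close> behaves like a vector space of dimension at most \<open>r\<close>. The induction
  is Gaussian elimination, adding at most one pivot vector per coordinate.\<close>

lemma homogeneous_part_finitely_generated:
  fixes W :: "('n::finite, 'k::field) mpoly vec set"
  assumes hom: "\<And>v. v \<in> W \<Longrightarrow> hom_vec r D b v"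
    and closed: "\<And>u v a. u \<in> W \<Longrightarrow> v \<in> W \<Longrightarrow> u + single 0 a \<cdot>\<^sub>v v \<in> W"
  shows "\<exists>G. finite G \<and> G \<subseteq> W \<and> W \<subseteq> module_span r G"
proof -
  have carr: "v \<in> W \<Longrightarrow> v \<in> carrier_vec r" for v using hom by (auto simp: hom_vec_def)
  have "\<exists>G. finite G \<and> G \<subseteq> W \<and> (\<forall>v\<in>W. (\<forall>i<r. t \<le> i \<longrightarrow> v $ i = 0) \<longrightarrow> v \<in> module_span r G)" for t
  proof (induction t)
    case 0
    have "v \<in> module_span r {}" if v: "v \<in> W" and "\<forall>i<r. v $ i = 0" for v
    proof -
      have "v = 0\<^sub>v r" by (rule eq_vecI) (use that carr[OF v] in auto)
      then show ?thesis by (simp add: module_span.zero)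
    qed
    then show ?case by (intro exI[of _ "{}"]) auto
  next
    case (Suc t)
    then obtain G where G: "finite G" "G \<subseteq> W"
      and span: "\<And>v. v \<in> W \<Longrightarrow> \<forall>i<r. t \<le> i \<longrightarrow> v $ i = 0 \<Longrightarrow> v \<in> module_span r G" by blast
    show ?case
    proof (cases "\<exists>w\<in>W. t < r \<and> (\<forall>i<r. Suc t \<le> i \<longrightarrow> w $ i = 0) \<and> w $ t \<noteq> 0")
      case False
      have "v \<in> module_span r G" if "v \<in> W" "\<forall>i<r. Suc t \<le> i \<longrightarrow> v $ i = 0" for v
      proof (rule span[OF that(1)], intro allI impI)
        fix i assume "i < r" "t \<le> i"
        then show "v $ i = 0" using that False by (cases "i = t") auto
      qed
      then show ?thesis using G by blast
    next
      case True
      then obtain w where w: "w \<in> W" "t < r" "\<And>i. i < r \<Longrightarrow> Suc t \<le> i \<Longrightarrow> w $ i = 0" "w $ t \<noteq> 0" by blast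
      then obtain m where "m \<in> keys (w $ t)" by (metis all_not_in_conv keys_eq_empty)
      then have m: "m + D t = b" and a: "lookup (w $ t) m \<noteq> 0"
        using hom[OF w(1)] w(2) by (auto simp: hom_vec_def in_keys_iff)
      have mono: "v $ t = single m (lookup (v $ t) m)" if v: "v \<in> W" for v
      proof (rule keys_subset_singleton)
        have "m' + D t = m + D t" if "m' \<in> keys (v $ t)" for m'
          using hom[OF v] w(2) that m by (auto simp: hom_vec_def)
        then show "keys (v $ t) \<subseteq> {m}" by auto
      qed
      have "v \<in> module_span r (insert w G)" if v: "v \<in> W" "\<forall>i<r. Suc t \<le> i \<longrightarrow> v $ i = 0" for v
      proof -
        \<comment> \<open>This scalar clears coordinate \<open>t\<close> of \<open>v\<close> against
          the pivot of \<open>w\<close>.\<close>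
        define c where "c = lookup (v $ t) m / lookup (w $ t) m"
        define u where "u = v + single 0 (- c) \<cdot>\<^sub>v w"
        have u: "u \<in> W" unfolding u_def by (rule closed) fact+
        have dims: "v \<in> carrier_vec r" "w \<in> carrier_vec r" using carr v w by auto
        have "u $ t = single m (lookup (v $ t) m) + single 0 (- c) * single m (lookup (w $ t) m)"
          unfolding u_def using dims w(2) mono[OF v(1)] mono[OF w(1)] by simp
        also have "\<dots> = 0" using a by (simp add: mult_single c_def single_add[symmetric])
        finally have "u $ t = 0" .
        moreover have "u $ i = 0" if "i < r" "Suc t \<le> i" for i
          using that v(2) w(3) dims by (simp add: u_def)
        ultimately have "u $ i = 0" if "i < r" "t \<le> i" for i
          using that by (cases "i = t") auto
        then have "u \<in> module_span r G" using span[OF u] by blast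
        then have "u \<in> module_span r (insert w G)" using module_span_mono[of G "insert w G"] by blast
        then have "single 0 c \<cdot>\<^sub>v w + u \<in> module_span r (insert w G)" by (rule module_span.add[rotated]) simp
        moreover have "single 0 c \<cdot>\<^sub>v w + u = v"
          by (rule eq_vecI) (use dims in \<open>auto simp: u_def single_uminus\<close>)
        ultimately show ?thesis by simp
      qed
      then show ?thesis using G w(1) by (intro exI[of _ "insert w G"]) auto
    qed
  qed
  from this[of r] show ?thesis by auto
qed

lemma hom_vec_component:
  assumes "v \<in> carrier_vec r" shows "hom_vec r D b (component D b v)"
  using assms by (auto simp: hom_vec_def component_def keys_restrict_keys)

text \<open>Generators of the homogeneous parts in the degrees of \<open>B\<close> suffice:
  homogeneous elements are monomial multiples of elements of those parts, and every other element is
  a finite sum of its components.\<close>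

lemma fine_submodule_finitely_generated:
  fixes N :: "('n::finite, 'k::field) mpoly vec set"
  assumes "fine_submodule r D N"
  shows "\<exists>G. finite G \<and> G \<subseteq> N \<and> (\<forall>g\<in>G. \<exists>b. hom_vec r D b g) \<and> N \<subseteq> module_span r G"
proof -
  have sub: "vec_submodule r N" and comp: "\<And>b v. v \<in> N \<Longrightarrow> component D b v \<in> N"
    and bd: "\<exists>B. finite B \<and> reducible_to_degrees r D N B"
    using assms by (simp_all add: fine_submodule_def)
  note N = vec_submoduleD(1,2)[OF sub] and add = vec_submoduleD(3)[OF sub] and smult = vec_submoduleD(4)[OF sub]
  obtain B where B: "finite B" and bounded: "reducible_to_degrees r D N B" using bd by auto
  define W where "W b = {v\<in>N. hom_vec r D b v}" for b
  have "\<exists>G. finite G \<and> G \<subseteq> W b \<and> W b \<subseteq> module_span r G" for b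
  proof (rule homogeneous_part_finitely_generated[of _ r D b])
    fix u v a assume uv: "u \<in> W b" "v \<in> W b"
    have "m + D i = b" if "i < r" "m \<in> keys (u $ i + single 0 a * v $ i)" for i m
    proof -
      have "m \<in> keys (u $ i) \<or> m \<in> keys (single 0 a * v $ i)" using that(2) keys_add[of "u $ i" "single 0 a * v $ i"] by blast
      then have "m \<in> keys (u $ i) \<or> m \<in> keys (v $ i)"
        using keys_multD[of m "single 0 a" "v $ i"] by (auto split: if_splits)
      then show ?thesis using uv that by (auto simp: W_def hom_vec_def)
    qed
    then show "u + single 0 a \<cdot>\<^sub>v v \<in> W b" using uv add smult by (auto simp: W_def hom_vec_def)
  qed (simp add: W_def)
  then obtain G where G: "\<And>b. finite (G b)" "\<And>b. G b \<subseteq> W b" "\<And>b. W b \<subseteq> module_span r (G b)" by metis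
  define H where "H = (\<Union>b\<in>B. G b)"
  have H: "finite H" "H \<subseteq> N" "\<forall>g\<in>H. \<exists>b. hom_vec r D b g"
    using G B by (auto simp: H_def W_def)
  have Hc: "H \<subseteq> carrier_vec r" using H N by blast
  have hom: "v \<in> module_span r H" if v: "v \<in> N" "hom_vec r D b v" for v b
  proof -
    obtain b' m v' where *: "b' \<in> B" "v' \<in> N" "hom_vec r D b' v'" "v = single m 1 \<cdot>\<^sub>v v'"
      using bounded[unfolded reducible_to_degrees_def, rule_format, OF v] by auto
    have "v' \<in> module_span r (G b')" using G(3)[of b'] * by (auto simp: W_def)
    then have "v' \<in> module_span r H" using module_span_mono[of "G b'" H] * by (auto simp: H_def)
    then show ?thesis using module_span_smult[OF Hc] * by simp
  qed
  \<comment> \<open>\<open>S\<close> is a finite set containing all multidegrees that occur in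
    \<open>v\<close>; subtracting a component removes one of them.\<close>
  have all: "v \<in> module_span r H"
    if "finite S" "v \<in> N" "\<And>i m. i < r \<Longrightarrow> m \<in> keys (v $ i) \<Longrightarrow> m + D i \<in> S" for S v
    using that
  proof (induction S arbitrary: v rule: finite_induct)
    case empty
    then have "v $ i = 0" if "i < r" for i using that by (metis all_not_in_conv empty_iff keys_eq_empty)
    then have "v = 0\<^sub>v r" using empty N by (intro eq_vecI) auto
    then show ?case by (simp add: module_span.zero)
  next
    case (insert b S)
    define u where "u = v + (- 1) \<cdot>\<^sub>v component D b v"
    have vc: "v \<in> carrier_vec r" using insert N by blast
    have u: "u \<in> N" unfolding u_def using insert by (intro add smult comp)
    have ui: "u $ i = restrict_keys (\<lambda>m. m + D i \<noteq> b) (v $ i)" if "i < r" for i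
      by (rule poly_mapping_eqI) (use vc that in \<open>simp add: u_def component_def lookup_restrict_keys lookup_minus\<close>)
    have "u \<in> module_span r H"
    proof (rule insert.IH[OF u])
      fix i m assume "i < r" "m \<in> keys (u $ i)"
      then show "m + D i \<in> S" using insert.prems(2)[of i m] by (auto simp: ui keys_restrict_keys)
    qed
    moreover have "component D b v \<in> module_span r H"
      by (rule hom[OF comp[OF insert.prems(1)] hom_vec_component[OF vc]])
    ultimately have "component D b v + u \<in> module_span r H" by (rule module_span_add[OF Hc, rotated])
    moreover have "component D b v + u = v"
      by (rule eq_vecI) (use vc in \<open>auto simp: u_def component_def\<close>)
    ultimately show ?case by simp
  qed
  have "N \<subseteq> module_span r H"
  proof
    fix v assume v: "v \<in> N"
    show "v \<in> module_span r H"
      by (rule all[OF _ v, of "\<Union>i<r. (\<lambda>m. m + D i) ` keys (v $ i)"]) auto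
  qed
  then show ?thesis using H by blast
qed

section \<open>Images and kernels of finely graded matrices\<close>

lemma vec_submoduleI:
  assumes "N \<subseteq> carrier_vec r" "0\<^sub>v r \<in> N" "\<And>u v. u \<in> N \<Longrightarrow> v \<in> N \<Longrightarrow> u + v \<in> N"
    and "\<And>f v. v \<in> N \<Longrightarrow> f \<cdot>\<^sub>v v \<in> N"
  shows "vec_submodule r N"
  using assms by (simp add: vec_submodule_def)

lemma vec_submodule_module_span:
  assumes "G \<subseteq> carrier_vec r" shows "vec_submodule r (module_span r G)"
proof (rule vec_submoduleI)
  show "module_span r G \<subseteq> carrier_vec r" using module_span_carrier[OF assms] by (rule subsetI)
qed (rule module_span.zero module_span_add[OF assms] module_span_smult[OF assms]; assumption)+

lemma vec_submodule_image:
  fixes M :: "'a::comm_ring_1 mat"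
  assumes M: "M \<in> carrier_mat r s"
  shows "vec_submodule r ((\<lambda>v. M *\<^sub>v v) ` carrier_vec s)"
proof (rule vec_submoduleI)
  show "(\<lambda>v. M *\<^sub>v v) ` carrier_vec s \<subseteq> carrier_vec r" using M by auto
  have "0\<^sub>v r = M *\<^sub>v 0\<^sub>v s" by (rule eq_vecI) (use M in auto)
  then show "0\<^sub>v r \<in> (\<lambda>v. M *\<^sub>v v) ` carrier_vec s" by simp
next
  fix x y assume "x \<in> (\<lambda>v. M *\<^sub>v v) ` carrier_vec s" "y \<in> (\<lambda>v. M *\<^sub>v v) ` carrier_vec s"
  then obtain u v where uv: "u \<in> carrier_vec s" "x = M *\<^sub>v u" "v \<in> carrier_vec s" "y = M *\<^sub>v v" by blast
  then have "x + y = M *\<^sub>v (u + v)" by (simp add: mult_add_distrib_mat_vec[OF M])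
  then show "x + y \<in> (\<lambda>v. M *\<^sub>v v) ` carrier_vec s" using uv by simp
next
  fix f x assume "x \<in> (\<lambda>v. M *\<^sub>v v) ` carrier_vec s"
  then obtain u where u: "u \<in> carrier_vec s" "x = M *\<^sub>v u" by blast
  then have "f \<cdot>\<^sub>v x = M *\<^sub>v (f \<cdot>\<^sub>v u)" by (simp add: mult_mat_vec_smult[OF M])
  then show "f \<cdot>\<^sub>v x \<in> (\<lambda>v. M *\<^sub>v v) ` carrier_vec s" using u by simp
qed

lemma vec_submodule_mat_kernel:
  fixes M :: "'a::comm_ring_1 mat"
  assumes M: "M \<in> carrier_mat r s"
  shows "vec_submodule s (mat_kernel M)"
proof (rule vec_submoduleI)
  show "mat_kernel M \<subseteq> carrier_vec s" by (rule mat_kernel_carrier[OF M])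
  have "M *\<^sub>v 0\<^sub>v s = 0\<^sub>v r" by (rule eq_vecI) (use M in auto)
  then show "0\<^sub>v s \<in> mat_kernel M" by (simp add: mat_kernel[OF M])
next
  fix u v assume "u \<in> mat_kernel M" "v \<in> mat_kernel M"
  then show "u + v \<in> mat_kernel M" by (simp add: mat_kernel[OF M] mult_add_distrib_mat_vec[OF M])
next
  fix f :: 'a and v assume v: "v \<in> mat_kernel M"
  have "f \<cdot>\<^sub>v 0\<^sub>v r = 0\<^sub>v r" by (rule eq_vecI) auto
  then show "f \<cdot>\<^sub>v v \<in> mat_kernel M" using v by (simp add: mat_kernel[OF M] mult_mat_vec_smult[OF M])
qed

lemma restrict_keys_sum:
  fixes f :: "'i \<Rightarrow> 'a \<Rightarrow>\<^sub>0 'b::comm_monoid_add"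
  shows "restrict_keys P (sum f A) = (\<Sum>i\<in>A. restrict_keys P (f i))"
  by (induction A rule: infinite_finite_induct) (simp_all add: restrict_keys_add)

definition hom_mat :: "nat \<Rightarrow> (nat \<Rightarrow> 'n::finite exps) \<Rightarrow> nat \<Rightarrow> (nat \<Rightarrow> 'n exps) \<Rightarrow> ('n, 'k::field) mpoly mat \<Rightarrow> bool" where
  "hom_mat r D s E M \<longleftrightarrow> M \<in> carrier_mat r s \<and> (\<forall>i<r. \<forall>j<s. \<forall>m\<in>keys (M $$ (i, j)). m + D i = E j)"

text \<open>Homogeneous maps preserve multidegrees. Consequently every component of a relation is
  again a relation, which allows relations to be made homogeneous.\<close>

lemma mult_mat_component:
  assumes "hom_mat r D s E M" and f: "f \<in> carrier_vec s"
  shows "M *\<^sub>v component E b f = component D b (M *\<^sub>v f)"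
proof (rule eq_vecI)
  from assms have M: "M \<in> carrier_mat r s" by (simp add: hom_mat_def)
  fix i assume "i < dim_vec (component D b (M *\<^sub>v f))"
  then have i: "i < r" using M by (simp add: component_def)
  have "M $$ (i, j) * restrict_keys (\<lambda>m. m + E j = b) (f $ j) =
      restrict_keys (\<lambda>m. m + D i = b) (M $$ (i, j) * f $ j)" if j: "j < s" for j
  proof (rule restrict_keys_mult[symmetric])
    fix p q assume "p \<in> keys (M $$ (i, j))"
    then have "p + D i = E j" using assms(1) i j by (simp add: hom_mat_def)
    then show "p + q + D i = b \<longleftrightarrow> q + E j = b" by (metis add.assoc add.commute)
  qed
  then show "(M *\<^sub>v component E b f) $ i = component D b (M *\<^sub>v f) $ i"
    using M f i by (simp add: component_def scalar_prod_def restrict_keys_sum)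
qed (use assms in \<open>simp add: component_def\<close>)

lemma component_zero: "component D b (0\<^sub>v r) = 0\<^sub>v r"
  by (rule eq_vecI) (auto simp: component_def)

text \<open>Let \<open>v\<close> be a homogeneous relation of degree \<open>b\<close>, and truncate
  \<open>b\<close> at \<open>c\<close> to \<open>b'\<close>. A nonzero coordinate \<open>j\<close>
  has \<open>E j\<close> below both \<open>b\<close> and \<open>c\<close>, hence below
  \<open>b'\<close>, so all coordinates share the monomial factor with exponent
  \<open>b - b'\<close>. Dividing it out yields a relation of degree \<open>b'\<close>.\<close>

lemma fine_submodule_mat_kernel:
  fixes M :: "('n::finite, 'k::field) mpoly mat"
  assumes hom: "hom_mat r D s E M"
  shows "fine_submodule s E (mat_kernel M)"
proof -
  from assms have M: "M \<in> carrier_mat r s" by (simp add: hom_mat_def)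
  \<comment> \<open>Only a common upper bound of the column degrees is needed, and the sum is a
    convenient one.\<close>
  define c where "c = (\<Sum>j<s. E j)"
  have Ec: "lookup (E j) x \<le> lookup c x" if "j < s" for j x
    unfolding c_def lookup_sum by (rule member_le_sum) (use that in auto)
  define B where "B = {b. \<forall>x. lookup b x \<le> lookup c x}"
  have "component E b v \<in> mat_kernel M" if "v \<in> mat_kernel M" for b v
    using that mult_mat_component[OF hom, of v b]
    by (auto simp: mat_kernel[OF M] component_zero) (auto simp: component_def)
  moreover have "reducible_to_degrees s E (mat_kernel M) B"
    unfolding reducible_to_degrees_def
  proof (intro allI ballI impI)
    fix b v assume v: "v \<in> mat_kernel M" and hv: "hom_vec s E b v"
    define b' where "b' = Abs_poly_mapping (\<lambda>x. min (lookup b x) (lookup c x))"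
    have lb': "lookup b' x = min (lookup b x) (lookup c x)" for x by (simp add: b'_def)
    define m where "m = b - b'"
    \<comment> \<open>The test guards against truncated subtraction of exponents. Where it fails,
      homogeneity forces \<open>v $ j = 0\<close>.\<close>
    define v' where "v' = vec s (\<lambda>j. if \<forall>x. lookup (E j) x \<le> lookup b x
      then single (b' - E j) (lookup (v $ j) (b - E j)) else 0)"
    have vj: "v $ j = single m 1 * v' $ j" if j: "j < s" for j
    proof (cases "v $ j = 0")
      case True
      then show ?thesis using j by (simp add: v'_def)
    next
      case False
      have key: "q = b - E j \<and> (\<forall>x. lookup (E j) x \<le> lookup b x)" if "q \<in> keys (v $ j)" for q
      proof -
        have "q + E j = b" using hv j that by (simp add: hom_vec_def)
        then show ?thesis by (auto simp: lookup_add)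
      qed
      obtain q where "q \<in> keys (v $ j)" using False by (metis all_not_in_conv keys_eq_empty)
      then have le: "\<forall>x. lookup (E j) x \<le> lookup b x" using key by blast
      have "v $ j = single (b - E j) (lookup (v $ j) (b - E j))"
        by (rule keys_subset_singleton) (use key in auto)
      moreover have "m + (b' - E j) = b - E j"
        by (rule poly_mapping_eqI) (use le Ec[OF j] in \<open>simp add: lookup_add lookup_minus m_def lb'\<close>)
      ultimately show ?thesis using j le by (simp add: v'_def mult_single)
    qed
    have v'c: "v' \<in> carrier_vec s" by (simp add: v'_def)
    have vc: "v \<in> carrier_vec s" and Mv: "M *\<^sub>v v = 0\<^sub>v r" using v by (simp_all add: mat_kernel[OF M])
    have veq: "v = single m 1 \<cdot>\<^sub>v v'" by (rule eq_vecI) (use vc v'c vj in auto)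
    have "single m 1 \<cdot>\<^sub>v (M *\<^sub>v v') = 0\<^sub>v r" using Mv by (simp add: veq mult_mat_vec_smult[OF M v'c])
    \<comment> \<open>Monomials are nonzerodivisors, so the factor can be cancelled from the
      relation.\<close>
    then have "single m 1 * (M *\<^sub>v v') $ i = 0" if "i < r" for i
      using that M by (metis index_smult_vec(1) index_zero_vec(1) dim_mult_mat_vec carrier_matD(1))
    then have "(M *\<^sub>v v') $ i = 0" if "i < r" for i using that by (simp add: single_mult_eq_0_iff)
    then have "M *\<^sub>v v' = 0\<^sub>v r" using M by (intro eq_vecI) auto
    then have "v' \<in> mat_kernel M" using v'c by (simp add: mat_kernel[OF M])
    moreover have "hom_vec s E b' v'"
    proof -
      have "p + E j = b'" if j: "j < s" and p: "p \<in> keys (v' $ j)" for j p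
      proof -
        have le: "\<forall>x. lookup (E j) x \<le> lookup b x" and "p = b' - E j"
          using j p by (auto simp: v'_def split: if_splits)
        then show ?thesis
          using Ec[OF j] by (intro poly_mapping_eqI) (simp add: lookup_add lookup_minus lb')
      qed
      then show ?thesis using v'c by (simp add: hom_vec_def)
    qed
    moreover have "b' \<in> B" by (simp add: B_def lb')
    ultimately show "\<exists>b'\<in>B. \<exists>m. \<exists>v'\<in>mat_kernel M. hom_vec s E b' v' \<and> v = single m 1 \<cdot>\<^sub>v v'"
      using veq by blast
  qed
  moreover have "finite B" unfolding B_def by (rule finite_exps_le)
  ultimately show ?thesis using vec_submodule_mat_kernel[OF M] unfolding fine_submodule_def by (intro conjI exI[of _ B]) auto
qed

text \<open>A homogeneous generating set of least cardinality has no relation with a constant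
  coefficient: such a relation would express one generator through the others.\<close>

lemma minimal_presentation:
  fixes N :: "('n::finite, 'k::field) mpoly vec set"
  assumes N: "fine_submodule r D N"
  shows "\<exists>s E M. hom_mat r D s E M \<and> (\<lambda>v. M *\<^sub>v v) ` carrier_vec s = N \<and>
    (\<forall>v\<in>mat_kernel M. \<forall>j<s. v $ j \<in> irrelevant_ideal)"
proof -
  define Q where "Q G \<longleftrightarrow> finite G \<and> G \<subseteq> N \<and> (\<forall>g\<in>G. \<exists>b. hom_vec r D b g) \<and> N \<subseteq> module_span r G" for G
  have sub: "vec_submodule r N" using N by (simp add: fine_submodule_def)
  have "\<exists>G. Q G" using fine_submodule_finitely_generated[OF N] by (simp add: Q_def)
  then obtain G where G: "Q G" and min: "\<And>G'. Q G' \<Longrightarrow> card G \<le> card G'"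
    using ex_has_least_nat[of Q _ card] by metis
  have fin: "finite G" and GN: "G \<subseteq> N" and Ghom: "\<forall>g\<in>G. \<exists>b. hom_vec r D b g" and span: "N \<subseteq> module_span r G"
    using G by (simp_all add: Q_def)
  have Gc: "G \<subseteq> carrier_vec r" using GN vec_submoduleD(1)[OF sub] by (rule subset_trans)
  obtain gs where gs: "set gs = G" "distinct gs" using finite_distinct_list[OF fin] by auto
  obtain deg where deg: "\<forall>g\<in>G. hom_vec r D (deg g) g" using bchoice[OF Ghom] by auto
  define s where "s = length gs"
  define M where "M = mat_of_cols r gs"
  define E where "E j = deg (gs ! j)" for j
  have M: "M \<in> carrier_mat r s" by (simp add: M_def s_def)
  have gsG: "gs ! j \<in> G" if "j < s" for j using that gs nth_mem[of j gs] by (simp add: s_def)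
  have col: "col M j = gs ! j" if "j < s" for j
    unfolding M_def by (rule col_mat_of_cols) (use that gsG[OF that] Gc in \<open>auto simp: s_def\<close>)
  have hom: "hom_mat r D s E M"
    unfolding hom_mat_def
  proof (intro conjI M allI impI ballI)
    fix i j m assume ij: "i < r" "j < s" and m: "m \<in> keys (M $$ (i, j))"
    have "M $$ (i, j) = gs ! j $ i" using ij by (simp add: M_def mat_of_cols_def s_def)
    then show "m + D i = E j" using deg gsG[OF ij(2)] ij m by (simp add: hom_vec_def E_def)
  qed
  have image: "(\<lambda>v. M *\<^sub>v v) ` carrier_vec s = N"
  proof (rule subset_antisym)
    have "M *\<^sub>v v \<in> N" if "v \<in> carrier_vec s" for v
    proof -
      have "{col M j | j. j < s \<and> v $ j \<noteq> 0} \<subseteq> N" using col gsG GN by auto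
      then show ?thesis by (rule subsetD[OF module_span_subset[OF _ sub] mult_mat_vec_in_span[OF M that]])
    qed
    then show "(\<lambda>v. M *\<^sub>v v) ` carrier_vec s \<subseteq> N" by auto
    have "g \<in> (\<lambda>v. M *\<^sub>v v) ` carrier_vec s" if g: "g \<in> G" for g
    proof -
      obtain j where j: "j < s" "gs ! j = g" using g gs by (auto simp: in_set_conv_nth s_def)
      then have "g = M *\<^sub>v unit_vec s j" by (simp add: mult_mat_vec_unit_vec[OF M] col)
      then show ?thesis by simp
    qed
    then have "module_span r G \<subseteq> (\<lambda>v. M *\<^sub>v v) ` carrier_vec s"
      by (rule module_span_subset[OF subsetI vec_submodule_image[OF M]])
    then show "N \<subseteq> (\<lambda>v. M *\<^sub>v v) ` carrier_vec s" using span by (rule subset_trans[rotated])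
  qed
  have "f $ j \<in> irrelevant_ideal" if f: "f \<in> mat_kernel M" and j: "j < s" for f j
  proof (rule ccontr)
    assume "f $ j \<notin> irrelevant_ideal"
    then have nz: "lookup (f $ j) 0 \<noteq> 0" by (simp add: irrelevant_ideal_def)
    define a where "a = lookup (f $ j) 0"
    \<comment> \<open>In degree \<open>E j\<close> the entry \<open>j\<close> keeps exactly its
      constant term, so generator \<open>j\<close> appears with an invertible coefficient.\<close>
    define f' where "f' = component E (E j) f"
    have fc: "f \<in> carrier_vec s" using f by (simp add: mat_kernel[OF M])
    have f': "f' \<in> carrier_vec s" "M *\<^sub>v f' = 0\<^sub>v r"
      using f fc mult_mat_component[OF hom fc]
      by (simp_all add: f'_def mat_kernel[OF M] component_zero) (simp add: component_def)
    have f'j: "f' $ j = single 0 a"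
      using j fc by (intro poly_mapping_eqI)
        (auto simp: f'_def component_def lookup_restrict_keys a_def lookup_single when_def)
    \<comment> \<open>The relation is divided by \<open>- a\<close>; \<open>h\<close> holds the
      coefficients of the other generators, which then sum to generator \<open>j\<close>.\<close>
    define h where "h = vec s (\<lambda>i. if i = j then 0 else single 0 (- inverse a) * f' $ i)"
    have h: "h \<in> carrier_vec s" by (simp add: h_def)
    have "single 0 (- inverse a) \<cdot>\<^sub>v f' = h + (- 1) \<cdot>\<^sub>v unit_vec s j"
      by (rule eq_vecI) (use f' f'j j nz in \<open>auto simp: h_def mult_single single_uminus a_def\<close>)
    then have "M *\<^sub>v (single 0 (- inverse a) \<cdot>\<^sub>v f') = M *\<^sub>v h + (- 1) \<cdot>\<^sub>v gs ! j"
      using h j by (simp add: mult_add_distrib_mat_vec[OF M] mult_mat_vec_smult[OF M] mult_mat_vec_unit_vec[OF M] col)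
    then have eq: "single 0 (- inverse a) \<cdot>\<^sub>v 0\<^sub>v r = M *\<^sub>v h + (- 1) \<cdot>\<^sub>v gs ! j"
      using f' by (simp add: mult_mat_vec_smult[OF M])
    have gc: "gs ! j \<in> carrier_vec r" using gsG[OF j] Gc by auto
    have "gs ! j = M *\<^sub>v h"
    proof (rule eq_vecI)
      fix i assume i: "i < dim_vec (M *\<^sub>v h)"
      have "(single 0 (- inverse a) \<cdot>\<^sub>v 0\<^sub>v r) $ i = (M *\<^sub>v h + (- 1) \<cdot>\<^sub>v gs ! j) $ i" using eq by simp
      then show "gs ! j $ i = (M *\<^sub>v h) $ i" using i M gc by simp
    qed (use M gc in simp)
    then have in_span: "gs ! j \<in> module_span r {col M i | i. i < s \<and> h $ i \<noteq> 0}"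
      using mult_mat_vec_in_span[OF M h] by simp
    have "{col M i | i. i < s \<and> h $ i \<noteq> 0} \<subseteq> G - {gs ! j}"
    proof
      fix g assume "g \<in> {col M i | i. i < s \<and> h $ i \<noteq> 0}"
      then obtain i where i: "i < s" "h $ i \<noteq> 0" "g = col M i" by auto
      then have "i \<noteq> j" by (auto simp: h_def)
      then have "gs ! i \<noteq> gs ! j" using i j gs(2) by (simp add: s_def nth_eq_iff_index_eq)
      then show "g \<in> G - {gs ! j}" using i gsG col by simp
    qed
    then have in_span': "gs ! j \<in> module_span r (G - {gs ! j})"
      by (rule subsetD[OF module_span_mono in_span])
    have Gc': "G - {gs ! j} \<subseteq> carrier_vec r" using Gc by auto
    have "G \<subseteq> module_span r (G - {gs ! j})"
    proof
      fix g assume g: "g \<in> G"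
      show "g \<in> module_span r (G - {gs ! j})"
      proof (cases "g = gs ! j")
        case False
        then show ?thesis using module_span_base[of g "G - {gs ! j}" r 1] g Gc by auto
      qed (use in_span' in simp)
    qed
    then have "module_span r G \<subseteq> module_span r (G - {gs ! j})"
      by (rule module_span_subset[OF _ vec_submodule_module_span[OF Gc']])
    then have "Q (G - {gs ! j})" using fin GN Ghom span by (auto simp: Q_def)
    then have "card G \<le> card (G - {gs ! j})" by (rule min)
    then show False using card_Diff1_less[OF fin gsG[OF j]] by simp
  qed
  then show ?thesis using hom image by (intro exI[of _ s] exI[of _ E] exI[of _ M]) auto
qed

section \<open>Existence of minimal free resolutions\<close>

lemma mdeg_add: "mdeg (p + q) = mdeg p + mdeg q"
  by (simp add: mdeg_eq)

lemma mdeg_0 [simp]: "mdeg 0 = 0"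
  by (simp add: mdeg_eq)

text \<open>Each step presents the current syzygy module by a minimal generating set and passes to
  the kernel, which is again finely graded. The inclusion
  \<open>J \<subseteq> irrelevant_ideal\<close> starts the invariant that makes the maps
  minimal.\<close>

lemma minimal_free_resolution_exists:
  fixes J :: "('n::finite, 'k::field) mpoly set"
  assumes J: "fine_submodule 1 (\<lambda>_. 0) {v \<in> carrier_vec 1. v $ 0 \<in> J}" and irr: "J \<subseteq> irrelevant_ideal"
  shows "\<exists>F. minimal_free_resolution J F"
proof -
  define N0 where "N0 = {v \<in> carrier_vec 1. v $ 0 \<in> J}"
  \<comment> \<open>A state consists of a rank, the multidegrees of the basis, and the submodule
    still to be resolved.\<close>
  define P :: "nat \<Rightarrow> nat \<times> (nat \<Rightarrow> 'n exps) \<times> ('n, 'k) mpoly vec set \<Rightarrow> bool"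
    where "P n x \<longleftrightarrow> fine_submodule (fst x) (fst (snd x)) (snd (snd x)) \<and>
      (\<forall>v\<in>snd (snd x). \<forall>i<fst x. v $ i \<in> irrelevant_ideal) \<and> (n = 0 \<longrightarrow> x = (1, \<lambda>_. 0, N0))" for n x
  define Q :: "nat \<times> (nat \<Rightarrow> 'n exps) \<times> ('n, 'k) mpoly vec set \<Rightarrow> nat \<times> (nat \<Rightarrow> 'n exps) \<times> ('n, 'k) mpoly vec set
     \<Rightarrow> ('n, 'k) mpoly mat \<Rightarrow> bool"
    where "Q x y M \<longleftrightarrow> hom_mat (fst x) (fst (snd x)) (fst y) (fst (snd y)) M \<and>
      (\<lambda>v. M *\<^sub>v v) ` carrier_vec (fst y) = snd (snd x) \<and> snd (snd y) = mat_kernel M" for x y M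
  have "\<exists>f. \<forall>n. P n (f n) \<and> (\<exists>M. Q (f n) (f (Suc n)) M)"
  proof (rule dependent_nat_choice)
    show "\<exists>x. P 0 x" using J irr by (intro exI[of _ "(1, \<lambda>_. 0, N0)"]) (auto simp: P_def N0_def)
  next
    fix x n assume "P n x"
    then have "fine_submodule (fst x) (fst (snd x)) (snd (snd x))" by (simp add: P_def)
    from minimal_presentation[OF this] obtain s E M where M: "hom_mat (fst x) (fst (snd x)) s E M"
      "(\<lambda>v. M *\<^sub>v v) ` carrier_vec s = snd (snd x)" "\<forall>v\<in>mat_kernel M. \<forall>j<s. v $ j \<in> irrelevant_ideal"
      by auto
    have "P (Suc n) (s, E, mat_kernel M)"
      using fine_submodule_mat_kernel[OF M(1)] M(3) by (simp add: P_def)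
    moreover have "Q x (s, E, mat_kernel M) M" using M by (simp add: Q_def)
    ultimately show "\<exists>y. P (Suc n) y \<and> (\<exists>M. Q x y M)" by (intro exI conjI)
  qed
  then obtain f where P: "\<And>n. P n (f n)" and "\<forall>n. \<exists>M. Q (f n) (f (Suc n)) M" by auto
  then obtain Ms where Q: "\<And>n. Q (f n) (f (Suc n)) (Ms n)" using choice[of "\<lambda>n M. Q (f n) (f (Suc n)) M"] by auto
  define R where "R n = fst (f n)" for n
  define D where "D n = fst (snd (f n))" for n
  define N where "N n = snd (snd (f n))" for n
  have f0: "R 0 = 1" "D 0 = (\<lambda>_. 0)" "N 0 = N0" using P[of 0] by (simp_all add: P_def R_def D_def N_def)
  have hom: "hom_mat (R n) (D n) (R (Suc n)) (D (Suc n)) (Ms n)"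
    and image: "(\<lambda>v. Ms n *\<^sub>v v) ` carrier_vec (R (Suc n)) = N n" and ker: "N (Suc n) = mat_kernel (Ms n)" for n
    using Q[of n] by (simp_all add: Q_def R_def D_def N_def)
  have Nirr: "v $ i \<in> irrelevant_ideal" if "v \<in> N n" "i < R n" for v i n
    using P[of n] that by (simp add: P_def R_def N_def)
  have carr: "Ms n \<in> carrier_mat (R n) (R (Suc n))" for n using hom[of n] by (simp add: hom_mat_def)
  have J0: "0 \<in> J"
  proof -
    have "0\<^sub>v 1 \<in> N0" using J unfolding N0_def fine_submodule_def by (intro vec_submoduleD(2)) simp
    then show ?thesis by (simp add: N0_def)
  qed
  \<comment> \<open>\<open>F_0\<close> is the ring itself in degree 0 with augmentation 1, and
    multidegrees are coarsened to total degrees.\<close>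
  define F where "F = \<lparr>res_rank = R, res_deg = (\<lambda>i c. int (mdeg (D i c))), res_aug = vec 1 (\<lambda>_. 1), res_map = Ms\<rparr>"
  have F: "res_rank F = R" "res_deg F = (\<lambda>i c. int (mdeg (D i c)))" "res_aug F = vec 1 (\<lambda>_. 1)" "res_map F = Ms"
    by (simp_all add: F_def)
  have prod: "scalar_prod (vec 1 (\<lambda>_. 1)) v = v $ 0" if "v \<in> carrier_vec 1" for v :: "('n, 'k) mpoly vec"
    using that by (simp add: scalar_prod_def)
  \<comment> \<open>Each column lies in the submodule being presented, whose vectors have entries in
    the irrelevant ideal by the invariant.\<close>
  have entries: "Ms i $$ (r, c) \<in> irrelevant_ideal" if "r < R i" "c < R (Suc i)" for i r c
  proof -
    have "Ms i *\<^sub>v unit_vec (R (Suc i)) c \<in> N i" unfolding image[symmetric] by simp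
    then have "col (Ms i) c $ r \<in> irrelevant_ideal"
      using Nirr[of _ i r] that mult_mat_vec_unit_vec[OF carr that(2)] by simp
    then show ?thesis using that carr[of i] by simp
  qed
  have degs: "Ms i $$ (r, c) \<in> graded_component (int (mdeg (D (Suc i) c)) - int (mdeg (D i r)))"
    if "r < R i" "c < R (Suc i)" for i r c
  proof -
    have "mdeg m + mdeg (D i r) = mdeg (D (Suc i) c)" if "m \<in> keys (Ms i $$ (r, c))" for m
      using hom[of i] \<open>r < R i\<close> \<open>c < R (Suc i)\<close> that by (simp add: hom_mat_def mdeg_add[symmetric])
    then show ?thesis by (force simp: graded_component_def)
  qed
  have "minimal_free_resolution J F"
    unfolding minimal_free_resolution_def F res_image_def f0 image
  proof (intro conjI)
    show "\<forall>g. \<exists>v\<in>carrier_vec 1. g - scalar_prod (vec 1 (\<lambda>_. 1)) v \<in> J"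
    proof
      fix g :: "('n, 'k) mpoly"
      show "\<exists>v\<in>carrier_vec 1. g - scalar_prod (vec 1 (\<lambda>_. 1)) v \<in> J"
        by (rule bexI[of _ "vec 1 (\<lambda>_. g)"]) (use J0 prod[of "vec 1 (\<lambda>_. g)"] in simp_all)
    qed
    show "{v \<in> carrier_vec 1. scalar_prod (vec 1 (\<lambda>_. 1)) v \<in> J} = N0"
      unfolding N0_def by (rule Collect_cong) (use prod in auto)
    show "\<forall>c<1. (vec 1 (\<lambda>_. 1) :: ('n, 'k) mpoly vec) $ c \<in> graded_component (int (mdeg (0 :: 'n exps)))"
      by (simp add: graded_component_def)
  qed (use carr entries degs ker in simp_all)
  then show ?thesis by blast
qed

section \<open>Vanishing of high syzygies\<close>

text \<open>Substitution of zero for the variables in \<open>A\<close>. Equality of images expresses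
  congruence modulo these variables while staying in the same ring.\<close>

definition kill_vars :: "'n::finite set \<Rightarrow> ('n, 'k::field) mpoly \<Rightarrow> ('n, 'k) mpoly" where
  "kill_vars A = restrict_keys (\<lambda>m. degree_in A m = 0)"

lemma kill_vars_add: "kill_vars A (f + g) = kill_vars A f + kill_vars A g"
  by (simp add: kill_vars_def restrict_keys_add)

lemma kill_vars_mult: "kill_vars A (f * g) = kill_vars A f * kill_vars A g"
proof -
  have "kill_vars A (f * g) = kill_vars A (kill_vars A f * g) +
      kill_vars A (restrict_keys (\<lambda>m. degree_in A m \<noteq> 0) f * g)"
    using restrict_keys_split[of f "\<lambda>m. degree_in A m = 0"]
    by (metis kill_vars_def distrib_right kill_vars_add)
  also have "kill_vars A (restrict_keys (\<lambda>m. degree_in A m \<noteq> 0) f * g) = 0"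
    unfolding kill_vars_def by (rule restrict_keys_eq_0) (auto dest!: keys_multD simp: keys_restrict_keys)
  also have "kill_vars A (kill_vars A f * g) = kill_vars A f * kill_vars A g"
    unfolding kill_vars_def by (rule restrict_keys_mult) (simp add: keys_restrict_keys)
  finally show ?thesis by simp
qed

lemma kill_vars_sum: "kill_vars A (sum f S) = (\<Sum>i\<in>S. kill_vars A (f i))"
  by (simp add: kill_vars_def restrict_keys_sum)

lemma kill_vars_mono: "A \<subseteq> B \<Longrightarrow> kill_vars B (kill_vars A f) = kill_vars B f"
proof (rule poly_mapping_eqI)
  fix m assume "A \<subseteq> B"
  then have "degree_in B m = 0 \<Longrightarrow> degree_in A m = 0" using degree_in_mono[of A B m] by simp
  then show "lookup (kill_vars B (kill_vars A f)) m = lookup (kill_vars B f) m"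
    by (simp add: kill_vars_def lookup_restrict_keys)
qed

lemma kill_vars_idem: "kill_vars A (kill_vars A f) = kill_vars A f"
  by (rule kill_vars_mono) simp

abbreviation kill_vars_vec :: "'n::finite set \<Rightarrow> ('n, 'k::field) mpoly vec \<Rightarrow> ('n, 'k) mpoly vec" where
  "kill_vars_vec A \<equiv> map_vec (kill_vars A)"

lemma kill_vars_vec_mult_mat:
  fixes M :: "('n::finite, 'k::field) mpoly mat"
  assumes "M \<in> carrier_mat r s" "v \<in> carrier_vec s"
  shows "kill_vars_vec A (M *\<^sub>v kill_vars_vec A v) = kill_vars_vec A (M *\<^sub>v v)"
  by (rule eq_vecI) (use assms in \<open>simp_all add: scalar_prod_def kill_vars_sum kill_vars_mult kill_vars_idem\<close>)

lemma kill_vars_vec_smult: "kill_vars_vec A (f \<cdot>\<^sub>v v) = kill_vars A f \<cdot>\<^sub>v kill_vars_vec A v"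
  by (rule eq_vecI) (simp_all add: kill_vars_mult)

lemma kill_vars_vec_add: "dim_vec u = dim_vec v \<Longrightarrow> kill_vars_vec A (u + v) = kill_vars_vec A u + kill_vars_vec A v"
  by (rule eq_vecI) (simp_all add: kill_vars_add)

lemma variable_dvd:
  fixes f :: "('n::finite, 'k::field) mpoly"
  assumes "\<And>m. m \<in> keys f \<Longrightarrow> lookup m x > 0"
  shows "\<exists>g. f = single (single x 1) 1 * g"
proof (rule poly_mapping_induct_single[of "\<lambda>f. \<exists>g. f = single (single x 1) 1 * g"])
  show "\<exists>g. 0 = single (single x 1) 1 * (g :: ('n, 'k) mpoly)" by (rule exI[of _ 0]) simp
next
  fix m assume "m \<in> keys f"
  then have "single x 1 + (m - single x 1) = m"
    using assms[of m] by (intro exps_le_imp_add) (auto simp: lookup_single when_def)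
  then show "\<exists>g. single m (lookup f m) = single (single x 1) 1 * g"
    by (intro exI[of _ "single (m - single x 1) (lookup f m)"]) (simp add: mult_single)
next
  fix g h :: "('n, 'k) mpoly"
  assume "\<exists>g'. g = single (single x 1) 1 * g'" "\<exists>h'. h = single (single x 1) 1 * h'"
  then obtain g' h' where "g = single (single x 1) 1 * g'" "h = single (single x 1) 1 * h'" by auto
  then have "g + h = single (single x 1) 1 * (g' + h')" by (simp add: distrib_left)
  then show "\<exists>g'. g + h = single (single x 1) 1 * g'" by (rule exI)
qed

text \<open>Setting one more variable to zero costs exactness in one more homological degree, because
  that variable is a nonzerodivisor on the free modules.\<close>

lemma exact_mod_vars:
  fixes M :: "nat \<Rightarrow> ('n::finite, 'k::field) mpoly mat" and R :: "nat \<Rightarrow> nat"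
  assumes carr: "\<And>i. M i \<in> carrier_mat (R i) (R (Suc i))"
    and exact: "\<And>i. mat_kernel (M i) = (\<lambda>v. M (Suc i) *\<^sub>v v) ` carrier_vec (R (Suc (Suc i)))"
  shows "finite A \<Longrightarrow> card A \<le> i \<Longrightarrow> v \<in> carrier_vec (R (Suc i)) \<Longrightarrow> kill_vars_vec A (M i *\<^sub>v v) = 0\<^sub>v (R i) \<Longrightarrow>
    \<exists>u\<in>carrier_vec (R (Suc (Suc i))). kill_vars_vec A v = kill_vars_vec A (M (Suc i) *\<^sub>v u)"
proof (induction A arbitrary: i v rule: finite_induct)
  case empty
  have id: "kill_vars {} f = f" for f :: "('n, 'k) mpoly"
    unfolding kill_vars_def by (rule restrict_keys_id) (simp add: degree_in_def)
  have idv: "kill_vars_vec {} w = w" for w :: "('n, 'k) mpoly vec" by (rule eq_vecI) (simp_all add: id)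
  have "v \<in> mat_kernel (M i)" using empty by (simp add: idv mat_kernel[OF carr])
  then show ?case unfolding exact idv by auto
next
  case (insert x A)
  \<comment> \<open>The index is positive because the enlarged set is nonempty: one homological
    degree is spent on \<open>x\<close>.\<close>
  then obtain i' where i: "i = Suc i'" and i': "card A \<le> i'" by (cases i) auto
  define t :: "('n, 'k) mpoly" where "t = single (single x 1) 1"
  have t0: "kill_vars (insert x A) t = 0"
    unfolding kill_vars_def by (rule restrict_keys_eq_0) (simp add: t_def degree_in_single)
  have tA: "kill_vars A t = t"
    unfolding kill_vars_def by (rule restrict_keys_id) (use insert.hyps in \<open>simp add: t_def degree_in_single\<close>)
  note v = insert.prems(2)[unfolded i]
  \<comment> \<open>Killing \<open>x\<close> in addition makes this vector zero, so each remaining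
    monomial contains \<open>x\<close>; the quotient by \<open>x\<close> becomes
    \<open>w\<close>.\<close>
  define y where "y = kill_vars_vec A (M i *\<^sub>v v)"
  have yc: "y \<in> carrier_vec (R i)" using mult_mat_vec_carrier[OF carr insert.prems(2)] by (simp add: y_def)
  have "\<exists>g. y $ j = t * g" if j: "j < R i" for j
    unfolding t_def
  proof (rule variable_dvd)
    fix m assume m: "m \<in> keys (y $ j)"
    have z: "kill_vars (insert x A) ((M i *\<^sub>v v) $ j) = 0"
      using arg_cong[OF insert.prems(3), of "\<lambda>v. v $ j"] j carr[of i] by simp
    have y: "y $ j = kill_vars A ((M i *\<^sub>v v) $ j)" using j carr[of i] by (simp add: y_def)
    have mA: "degree_in A m = 0" and mk: "m \<in> keys ((M i *\<^sub>v v) $ j)"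
      using m unfolding y by (simp_all add: kill_vars_def keys_restrict_keys)
    have "degree_in (insert x A) m \<noteq> 0"
    proof
      assume "degree_in (insert x A) m = 0"
      then have "m \<in> keys (kill_vars (insert x A) ((M i *\<^sub>v v) $ j))"
        using mk by (simp add: kill_vars_def keys_restrict_keys)
      then show False by (simp add: z)
    qed
    moreover have "degree_in (insert x A) m = lookup m x + degree_in A m"
      using insert.hyps by (simp add: degree_in_def)
    ultimately show "0 < lookup m x" using mA by simp
  qed
  then have "\<forall>j. \<exists>g. j < R i \<longrightarrow> y $ j = t * g" by auto
  then obtain g where g: "\<forall>j. j < R i \<longrightarrow> y $ j = t * g j" using choice[of "\<lambda>j g. j < R i \<longrightarrow> y $ j = t * g"] by auto
  define w where "w = vec (R i) g"
  have wc: "w \<in> carrier_vec (R i)" by (simp add: w_def)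
  have yw: "y = t \<cdot>\<^sub>v w" by (rule eq_vecI) (use yc g in \<open>auto simp: w_def\<close>)
  \<comment> \<open>The composite of two maps is zero. Cancelling \<open>t\<close> then shows that
    \<open>w\<close> is a cycle modulo \<open>A\<close> one degree lower, where the induction
    hypothesis provides \<open>w'\<close>.\<close>
  have "M i *\<^sub>v v \<in> mat_kernel (M i')" unfolding exact i using v by simp
  then have "M i' *\<^sub>v (M i *\<^sub>v v) = 0\<^sub>v (R i')" by (simp add: mat_kernel[OF carr])
  then have "kill_vars_vec A (M i' *\<^sub>v y) = kill_vars_vec A (0\<^sub>v (R i'))"
    unfolding y_def using mult_mat_vec_carrier[OF carr v] i by (subst kill_vars_vec_mult_mat[OF carr]) auto
  also have "kill_vars_vec A (0\<^sub>v (R i')) = (0\<^sub>v (R i') :: ('n, 'k) mpoly vec)"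
    by (rule eq_vecI) (auto simp: kill_vars_def)
  also have "M i' *\<^sub>v y = t \<cdot>\<^sub>v (M i' *\<^sub>v w)" unfolding yw by (rule mult_mat_vec_smult[OF carr]) (use wc i in simp)
  finally have tz: "t \<cdot>\<^sub>v kill_vars_vec A (M i' *\<^sub>v w) = 0\<^sub>v (R i')" by (simp add: kill_vars_vec_smult tA)
  have "kill_vars_vec A (M i' *\<^sub>v w) = 0\<^sub>v (R i')"
  proof (rule eq_vecI)
    fix j assume j: "j < dim_vec (0\<^sub>v (R i') :: ('n, 'k) mpoly vec)"
    have "t * kill_vars_vec A (M i' *\<^sub>v w) $ j = 0"
      using arg_cong[OF tz, of "\<lambda>v. v $ j"] j carr[of i'] by simp
    then show "kill_vars_vec A (M i' *\<^sub>v w) $ j = 0\<^sub>v (R i') $ j"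
      using j unfolding t_def single_mult_eq_0_iff by simp
  qed (use carr[of i'] in simp)
  from insert.IH[OF i' _ this] wc i obtain w' where w': "w' \<in> carrier_vec (R (Suc i))"
    and ww': "kill_vars_vec A w = kill_vars_vec A (M i *\<^sub>v w')" by auto
  \<comment> \<open>The correction by \<open>t\<close> times \<open>w'\<close> turns
    \<open>v\<close> into a cycle modulo \<open>A\<close> and is invisible once \<open>x\<close> is
    killed. The induction hypothesis applies a second time, now in degree \<open>i\<close>.\<close>
  define v' where "v' = v + (- t) \<cdot>\<^sub>v w'"
  have v'c: "v' \<in> carrier_vec (R (Suc i))" using insert.prems(2) w' by (simp add: v'_def)
  have "kill_vars_vec A (M i *\<^sub>v v') = 0\<^sub>v (R i)"
  proof (rule eq_vecI)
    fix j assume "j < dim_vec (0\<^sub>v (R i) :: ('n, 'k) mpoly vec)"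
    then have j: "j < R i" by simp
    have Mv': "M i *\<^sub>v v' = M i *\<^sub>v v + (- t) \<cdot>\<^sub>v (M i *\<^sub>v w')"
      unfolding v'_def using insert.prems(2) w'
      by (simp add: mult_add_distrib_mat_vec[OF carr] mult_mat_vec_smult[OF carr])
    have mt: "kill_vars A (- t) = - t"
      unfolding kill_vars_def by (rule restrict_keys_id) (use insert.hyps in \<open>simp add: t_def degree_in_single\<close>)
    have "kill_vars_vec A (M i *\<^sub>v v') = y + (- t) \<cdot>\<^sub>v kill_vars_vec A w"
      unfolding Mv' ww' using carr[of i] by (simp add: kill_vars_vec_add kill_vars_vec_smult mt y_def)
    moreover have "y = t \<cdot>\<^sub>v kill_vars_vec A w"
    proof (rule eq_vecI)
      fix j assume "j < dim_vec (t \<cdot>\<^sub>v kill_vars_vec A w)"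
      then have j: "j < R i" using wc by simp
      have "y $ j = kill_vars A (y $ j)" using j carr[of i] by (simp add: y_def kill_vars_idem)
      also have "\<dots> = t * kill_vars A (w $ j)" using j wc by (simp add: yw kill_vars_mult tA)
      finally show "y $ j = (t \<cdot>\<^sub>v kill_vars_vec A w) $ j" using j wc by simp
    qed (use yc wc in simp)
    ultimately show "kill_vars_vec A (M i *\<^sub>v v') $ j = 0\<^sub>v (R i) $ j" using j wc by simp
  qed (use carr[of i] in simp)
  from insert.IH[OF _ v'c this] i i' obtain u where u: "u \<in> carrier_vec (R (Suc (Suc i)))"
    and uv: "kill_vars_vec A v' = kill_vars_vec A (M (Suc i) *\<^sub>v u)" by auto
  have mono: "kill_vars_vec (insert x A) (kill_vars_vec A z) = kill_vars_vec (insert x A) z"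
    for z :: "('n, 'k) mpoly vec"
    by (rule eq_vecI) (auto intro: kill_vars_mono)
  have mt0: "kill_vars (insert x A) (- t) = 0"
    unfolding kill_vars_def by (rule restrict_keys_eq_0) (simp add: t_def degree_in_single)
  have km: "kill_vars (insert x A) (f - t * g) = kill_vars (insert x A) f" for f g
  proof -
    have "f - t * g = f + (- t) * g" by simp
    then show ?thesis by (simp only: kill_vars_add kill_vars_mult mt0) simp
  qed
  have "kill_vars_vec (insert x A) v' = kill_vars_vec (insert x A) (M (Suc i) *\<^sub>v u)"
    using arg_cong[OF uv, of "kill_vars_vec (insert x A)"] by (simp only: mono)
  moreover have "kill_vars_vec (insert x A) v' = kill_vars_vec (insert x A) v"
    by (rule eq_vecI) (use insert.prems(2) w' in \<open>simp_all add: v'_def km\<close>)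
  ultimately show ?case using u by auto
qed

lemma irrelevant_scalar_prod:
  fixes a v :: "('n::finite, 'k::field) mpoly vec"
  assumes "\<And>j. j < dim_vec v \<Longrightarrow> a $ j \<in> irrelevant_ideal"
  shows "scalar_prod a v \<in> irrelevant_ideal"
proof -
  have "lookup (a $ j * v $ j) 0 = 0" if "j < dim_vec v" for j
  proof (rule ccontr)
    assume "lookup (a $ j * v $ j) 0 \<noteq> 0"
    then have "0 \<in> keys (a $ j * v $ j)" by (simp add: in_keys_iff)
    then obtain p q where pq: "p \<in> keys (a $ j)" "0 = p + q" using keys_multD by blast
    have "mdeg p = 0" using pq(2) mdeg_add[of p q] by (metis add_is_0 mdeg_0)
    then have "p = 0" by (intro poly_mapping_eqI) (simp add: mdeg_def)
    then show False using assms[OF that] pq(1) by (simp add: irrelevant_ideal_def in_keys_iff)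
  qed
  then show ?thesis by (simp add: irrelevant_ideal_def scalar_prod_def lookup_sum)
qed

text \<open>Modulo all variables the maps of a minimal resolution are zero, so a unit vector is a
  cycle. Exactness, which persists from degree \<open>n\<close> on, would make it a boundary and
  hence zero. This is the length bound of the Hilbert syzygy theorem.\<close>

lemma minimal_free_resolution_rank_eq_0:
  fixes F :: "('n::finite, 'k::field) mpoly free_complex"
  assumes F: "minimal_free_resolution J F" and i: "card (UNIV :: 'n set) \<le> i"
  shows "res_rank F (Suc i) = 0"
proof (rule ccontr)
  assume "res_rank F (Suc i) \<noteq> 0"
  then have pos: "0 < res_rank F (Suc i)" by simp
  have carr: "res_map F i \<in> carrier_mat (res_rank F i) (res_rank F (Suc i))" for i
    using F by (simp add: minimal_free_resolution_def)
  have exact: "mat_kernel (res_map F i) = (\<lambda>v. res_map F (Suc i) *\<^sub>v v) ` carrier_vec (res_rank F (Suc (Suc i)))" for i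
    using F by (simp add: minimal_free_resolution_def res_image_def)
  have irr: "res_map F i $$ (r, c) \<in> irrelevant_ideal" if "r < res_rank F i" "c < res_rank F (Suc i)" for i r c
    using F that by (simp add: minimal_free_resolution_def)
  have zero: "kill_vars UNIV f = 0" if "f \<in> irrelevant_ideal" for f :: "('n, 'k) mpoly"
    unfolding kill_vars_def
  proof (rule restrict_keys_eq_0)
    fix m assume m: "m \<in> keys f"
    show "degree_in UNIV m \<noteq> 0"
    proof
      assume "degree_in UNIV m = 0"
      then have "m = 0" by (intro poly_mapping_eqI) (simp add: degree_in_def)
      then show False using m that by (simp add: irrelevant_ideal_def in_keys_iff)
    qed
  qed
  have vanish: "kill_vars_vec UNIV (res_map F i *\<^sub>v v) = 0\<^sub>v (res_rank F i)"
    if "v \<in> carrier_vec (res_rank F (Suc i))" for i v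
  proof (rule eq_vecI)
    fix j assume "j < dim_vec (0\<^sub>v (res_rank F i) :: ('n, 'k) mpoly vec)"
    then have j: "j < res_rank F i" by simp
    have "scalar_prod (row (res_map F i) j) v \<in> irrelevant_ideal"
      by (rule irrelevant_scalar_prod) (use that j irr carr[of i] in simp)
    then show "kill_vars_vec UNIV (res_map F i *\<^sub>v v) $ j = 0\<^sub>v (res_rank F i) $ j"
      using j carr[of i] zero by simp
  qed (use carr[of i] in simp)
  define e :: "('n, 'k) mpoly vec" where "e = unit_vec (res_rank F (Suc i)) 0"
  have "\<exists>u\<in>carrier_vec (res_rank F (Suc (Suc i))).
      kill_vars_vec UNIV e = kill_vars_vec UNIV (res_map F (Suc i) *\<^sub>v u)"
    by (rule exact_mod_vars[of "res_map F" "res_rank F", OF carr exact finite i _ vanish]) (simp_all add: e_def)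
  then have "kill_vars_vec UNIV e = 0\<^sub>v (res_rank F (Suc i))" using vanish by auto
  then have "kill_vars_vec UNIV e $ 0 = 0" using pos by simp
  then have "kill_vars UNIV (e $ 0) = 0" using pos by (simp add: e_def)
  moreover have "e $ 0 = 1" using pos by (simp add: e_def)
  moreover have "kill_vars UNIV 1 = (1 :: ('n, 'k) mpoly)"
    unfolding kill_vars_def by (rule restrict_keys_id) simp
  ultimately show False by simp
qed


section \<open>Generator degrees and regularity\<close>

text \<open>Encoding by the set of exponents reduces inclusions, intersections and colons to
  statements about exponents. That \<open>P\<close> is closed under adding exponents is assumed
  separately where the ideal property is used.\<close>

definition monomial_ideal :: "('n::finite exps \<Rightarrow> bool) \<Rightarrow> ('n, 'k::field) mpoly set" where
  "monomial_ideal P = {f. \<forall>m\<in>keys f. P m}"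

lemma keys_const_mult:
  fixes f :: "('n::finite, 'k::field) mpoly"
  assumes "a \<noteq> 0" shows "keys (single 0 a * f) = keys f"
  using assms lookup_single_mult[of 0 a f] by (auto simp: in_keys_iff)

lemma mdeg_eq_0_iff: "mdeg m = 0 \<longleftrightarrow> m = 0"
  by (auto simp: mdeg_def intro!: poly_mapping_eqI)

text \<open>Minimality forces \<open>F_0\<close> to be the ring in degree 0 with an invertible
  augmentation. The entries of the first map then lie in the ideal, and producing \<open>u\<close>
  from them requires an entry that contains \<open>u\<close> itself.\<close>

lemma minimal_free_resolution_generator_degree:
  fixes F :: "('n::finite, 'k::field) mpoly free_complex"
  assumes F: "minimal_free_resolution (monomial_ideal P) F"
    and proper: "\<not> P 0" and u: "P u" "\<And>m q. P m \<Longrightarrow> u = m + q \<Longrightarrow> m = u"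
  shows "\<exists>c<res_rank F (Suc 0). res_deg F (Suc 0) c = int (mdeg u)"
proof -
  define r where "r = res_rank F 0"
  define a where "a = res_aug F"
  define M where "M = res_map F 0"
  define s where "s = res_rank F (Suc 0)"
  have ac: "a \<in> carrier_vec r" and M: "M \<in> carrier_mat r s"
    and adeg: "\<And>c. c < r \<Longrightarrow> a $ c \<in> graded_component (res_deg F 0 c)"
    and Mdeg: "\<And>i j. i < r \<Longrightarrow> j < s \<Longrightarrow> M $$ (i, j) \<in> graded_component (res_deg F (Suc 0) j - res_deg F 0 i)"
    and surj: "\<And>f. \<exists>v\<in>carrier_vec r. f - scalar_prod a v \<in> monomial_ideal P"
    and ker: "{v \<in> carrier_vec r. scalar_prod a v \<in> monomial_ideal P} = (\<lambda>v. M *\<^sub>v v) ` carrier_vec s"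
    and Mirr: "\<And>i j. i < r \<Longrightarrow> j < s \<Longrightarrow> M $$ (i, j) \<in> irrelevant_ideal"
    using F by (simp_all add: minimal_free_resolution_def res_image_def r_def a_def M_def s_def)
  obtain v where v: "v \<in> carrier_vec r" "1 - scalar_prod a v \<in> monomial_ideal P" using surj by blast
  have "scalar_prod a v \<notin> irrelevant_ideal"
  proof
    assume "scalar_prod a v \<in> irrelevant_ideal"
    then have "lookup (1 - scalar_prod a v) 0 = 1" by (simp add: irrelevant_ideal_def lookup_minus)
    then have "0 \<in> keys (1 - scalar_prod a v)" by (simp add: in_keys_iff)
    then show False using v(2) proper by (auto simp: monomial_ideal_def)
  qed
  then obtain c where c: "c < r" "a $ c \<notin> irrelevant_ideal" using irrelevant_scalar_prod[of v a] v(1) by auto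
  define \<alpha> where "\<alpha> = lookup (a $ c) 0"
  have \<alpha>: "\<alpha> \<noteq> 0" using c(2) by (simp add: irrelevant_ideal_def \<alpha>_def)
  have "0 \<in> keys (a $ c)" using \<alpha> by (simp add: \<alpha>_def in_keys_iff)
  then have d0: "res_deg F 0 c = 0" using adeg[OF c(1)] by (auto simp: graded_component_def)
  have "keys (a $ c) \<subseteq> {0}" using adeg[OF c(1)] by (auto simp: graded_component_def d0 mdeg_eq_0_iff)
  then have a\<alpha>: "a $ c = single 0 \<alpha>" unfolding \<alpha>_def by (rule keys_subset_singleton)
  have im_irr: "w $ i \<in> irrelevant_ideal" if w: "w \<in> (\<lambda>v. M *\<^sub>v v) ` carrier_vec s" and i: "i < r" for w i
  proof -
    obtain y where y: "y \<in> carrier_vec s" "w = M *\<^sub>v y" using w by blast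
    have "scalar_prod (row M i) y \<in> irrelevant_ideal"
      by (rule irrelevant_scalar_prod) (use y i M Mirr in simp)
    then show ?thesis using y i M by simp
  qed
  \<comment> \<open>A second basis element could be corrected by a multiple of element
    \<open>c\<close> to lie in the kernel. This gives a relation with coefficient 1, which
    minimality excludes.\<close>
  have only: "c' = c" if c': "c' < r" for c'
  proof (rule ccontr)
    assume ne: "c' \<noteq> c"
    define b where "b = single 0 (- inverse \<alpha>) * a $ c'"
    define w where "w = unit_vec r c' + b \<cdot>\<^sub>v unit_vec r c"
    have wc: "w \<in> carrier_vec r" by (simp add: w_def)
    have "scalar_prod a w = a $ c' + b * a $ c"
      unfolding w_def using ac c' c(1) by (subst scalar_prod_add_distrib[of _ r]) simp_all
    also have "b * a $ c = (single 0 (- inverse \<alpha>) * single 0 \<alpha>) * a $ c'"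
      by (simp add: b_def a\<alpha> ac_simps)
    also have "\<dots> = - (a $ c')" using \<alpha> by (simp add: mult_single single_uminus)
    finally have "scalar_prod a w \<in> monomial_ideal P" by (simp add: monomial_ideal_def)
    then have "w \<in> (\<lambda>v. M *\<^sub>v v) ` carrier_vec s" using ker wc by blast
    then have "w $ c' \<in> irrelevant_ideal" by (rule im_irr[OF _ c'])
    then show False using ne c' c(1) by (simp add: w_def irrelevant_ideal_def)
  qed
  \<comment> \<open>All indices below \<open>r\<close> equal \<open>c\<close>; the first and the
    last one already force \<open>r = 1\<close>.\<close>
  have r: "r = 1" and c0: "c = 0" using only[of 0] only[of "r - 1"] c(1) by linarith+
  have prod: "scalar_prod a w = single 0 \<alpha> * w $ 0" if "w \<in> carrier_vec r" for w
    using that a\<alpha> by (simp add: scalar_prod_def r c0)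
  define w where "w = vec r (\<lambda>_. single u (1 :: 'k))"
  have wc: "w \<in> carrier_vec r" by (simp add: w_def)
  have "scalar_prod a w \<in> monomial_ideal P"
    using u(1) \<alpha> r by (simp add: prod[OF wc] monomial_ideal_def keys_const_mult) (simp add: w_def)
  then have "w \<in> (\<lambda>v. M *\<^sub>v v) ` carrier_vec s" using ker wc by blast
  then obtain y where y: "y \<in> carrier_vec s" "w = M *\<^sub>v y" by blast
  have "single u 1 = (\<Sum>j\<in>{0..<s}. M $$ (0, j) * y $ j)"
    using arg_cong[OF y(2), of "\<lambda>v. v $ 0"] y(1) M r by (simp add: w_def scalar_prod_def)
  then have "u \<in> keys (\<Sum>j\<in>{0..<s}. M $$ (0, j) * y $ j)"
    by (metis keys_single singletonI zero_neq_one)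
  then obtain j where j: "j < s" "u \<in> keys (M $$ (0, j) * y $ j)"
    using keys_sum_subset[of "\<lambda>j. M $$ (0, j) * y $ j" "{0..<s}"] by fastforce
  then obtain p q where pq: "p \<in> keys (M $$ (0, j))" "u = p + q" using keys_multD by blast
  have "col M j \<in> (\<lambda>v. M *\<^sub>v v) ` carrier_vec s"
    using mult_mat_vec_unit_vec[OF M j(1)] by (metis image_eqI unit_vec_carrier)
  then have "scalar_prod a (col M j) \<in> monomial_ideal P" "col M j \<in> carrier_vec r" using ker by auto
  \<comment> \<open>Column \<open>j\<close> is killed by the augmentation, so its exponent
    \<open>p\<close> belongs to the ideal; as a divisor of the minimal \<open>u\<close> it equals
    \<open>u\<close>.\<close>
  then have "P p" using pq(1) \<alpha> M j(1) r by (simp add: prod monomial_ideal_def keys_const_mult)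
  then have "p = u" using u(2) pq(2) by blast
  then have "int (mdeg u) = res_deg F (Suc 0) j"
    using Mdeg[of 0 j] j(1) pq(1) r d0 c0 by (simp add: graded_component_def)
  then show ?thesis using j(1) by (auto simp: s_def)
qed

text \<open>The \<open>- 1\<close> is the homological index: in a resolution of \<open>R / J\<close>
  the generators of \<open>J\<close> sit in \<open>F_1\<close>.\<close>

lemma regularity_quotient_ge:
  fixes u :: "'n::finite exps"
  assumes ex: "\<exists>F. minimal_free_resolution (monomial_ideal P :: ('n, 'k::field) mpoly set) F"
    and proper: "\<not> P 0" and u: "P u" "\<And>m q. P m \<Longrightarrow> u = m + q \<Longrightarrow> m = u"
  shows "int (mdeg u) - 1 \<le> regularity_quotient (monomial_ideal P :: ('n, 'k) mpoly set)"
proof -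
  define J where "J = (monomial_ideal P :: ('n, 'k) mpoly set)"
  define F where "F = min_resolution J"
  define S where "S = {j - int i | i j. graded_betti J i j \<noteq> 0}"
  have F: "minimal_free_resolution J F"
    unfolding F_def min_resolution_def J_def using ex by (rule someI_ex)
  have "\<exists>c<res_rank F (Suc 0). res_deg F (Suc 0) c = int (mdeg u)"
    by (rule minimal_free_resolution_generator_degree[OF F[unfolded J_def] proper u(1)]) (rule u(2))
  then obtain c where c: "c < res_rank F (Suc 0)" "res_deg F (Suc 0) c = int (mdeg u)" by blast
  have betti: "graded_betti J i j \<noteq> 0 \<longleftrightarrow> (\<exists>c<res_rank F i. res_deg F i c = j)" for i j
    by (auto simp: graded_betti_def F_def card_eq_0_iff)
  \<comment> \<open>Homological indices stop at \<open>n\<close> and every rank is finite, so the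
    maximum ranges over a finite set.\<close>
  have "S \<subseteq> (\<Union>i\<le>card (UNIV :: 'n set). (\<lambda>c. res_deg F i c - int i) ` {..<res_rank F i})"
  proof
    fix z assume "z \<in> S"
    then obtain i j where "graded_betti J i j \<noteq> 0" "z = j - int i" unfolding S_def by blast
    then obtain c where ic: "c < res_rank F i" "z = res_deg F i c - int i" unfolding betti by blast
    have "i \<le> card (UNIV :: 'n set)"
    proof (rule ccontr)
      assume "\<not> i \<le> card (UNIV :: 'n set)"
      then obtain i' where "i = Suc i'" "card (UNIV :: 'n set) \<le> i'" by (cases i) auto
      then show False using minimal_free_resolution_rank_eq_0[OF F] ic(1) by simp
    qed
    then show "z \<in> (\<Union>i\<le>card (UNIV :: 'n set). (\<lambda>c. res_deg F i c - int i) ` {..<res_rank F i})"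
      using ic by auto
  qed
  then have "finite S" by (rule finite_subset) auto
  moreover have "int (mdeg u) - 1 \<in> S"
    unfolding S_def betti using c by (intro CollectI exI[of _ "Suc 0"] exI[of _ "int (mdeg u)"]) auto
  ultimately have "int (mdeg u) - 1 \<le> Max S" by (rule Max_ge)
  then show ?thesis by (simp add: regularity_quotient_def S_def J_def)
qed

section \<open>Monomial ideals and monomial primes\<close>

lemma poly_ring_simps [simp]:
  "carrier poly_ring = (UNIV :: ('n::finite, 'k::field) mpoly set)"
  "monoid.mult poly_ring f g = f * (g :: ('n, 'k) mpoly)"
  "ring.add poly_ring f g = f + (g :: ('n, 'k) mpoly)"
  "monoid.one poly_ring = (1 :: ('n, 'k) mpoly)"
  "ring.zero poly_ring = (0 :: ('n, 'k) mpoly)"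
  by (simp_all add: ring_of_type_algebra_def)

lemma poly_idealI:
  fixes I :: "('n::finite, 'k::field) mpoly set"
  assumes "0 \<in> I" and add: "\<And>f g. f \<in> I \<Longrightarrow> g \<in> I \<Longrightarrow> f + g \<in> I"
    and mult: "\<And>f g. f \<in> I \<Longrightarrow> g * f \<in> I"
  shows "ideal I poly_ring"
proof (rule idealI)
  interpret ring "poly_ring :: ('n, 'k) mpoly ring" by (rule ring_from_type_algebra)
  show "ring (poly_ring :: ('n, 'k) mpoly ring)" by (rule ring_axioms)
  have inv: "m_inv (add_monoid poly_ring) f = - f" for f :: "('n, 'k) mpoly"
    unfolding a_inv_def[symmetric] by (rule minus_equality) simp_all
  show "subgroup I (add_monoid poly_ring)"
    unfolding subgroup_def inv using assms(1) add mult[of _ "- 1"] by auto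
qed (use mult in \<open>simp_all add: mult.commute\<close>)

lemma poly_idealD:
  fixes I :: "('n::finite, 'k::field) mpoly set"
  assumes "ideal I poly_ring"
  shows "0 \<in> I" "f \<in> I \<Longrightarrow> g \<in> I \<Longrightarrow> f + g \<in> I" "f \<in> I \<Longrightarrow> g * f \<in> I"
proof -
  interpret ideal I poly_ring by (rule assms)
  show "0 \<in> I" using additive_subgroup.zero_closed[OF ideal.axioms(1)[OF assms]] by simp
  show "f \<in> I \<Longrightarrow> g \<in> I \<Longrightarrow> f + g \<in> I"
    using additive_subgroup.a_closed[OF ideal.axioms(1)[OF assms], of f g] by simp
  show "f \<in> I \<Longrightarrow> g * f \<in> I" using I_l_closed[of f g] by simp
qed

lemma ideal_monomial_ideal:
  assumes up: "\<And>m q. P m \<Longrightarrow> P (m + q)"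
  shows "ideal (monomial_ideal P :: ('n::finite, 'k::field) mpoly set) poly_ring"
proof (rule poly_idealI)
  fix f g :: "('n, 'k) mpoly"
  assume f: "f \<in> monomial_ideal P"
  show "f + g \<in> monomial_ideal P" if "g \<in> monomial_ideal P"
    using f that keys_add[of f g] by (auto simp: monomial_ideal_def)
  show "g * f \<in> monomial_ideal P"
    unfolding monomial_ideal_def
  proof (intro CollectI ballI)
    fix m assume "m \<in> keys (g * f)"
    then obtain p q where "p \<in> keys g" "q \<in> keys f" "m = p + q" using keys_multD by blast
    then show "P m" using f up[of q p] by (simp add: monomial_ideal_def add.commute)
  qed
qed (simp add: monomial_ideal_def)

lemma monomial_ideal_subset_iff:
  "(monomial_ideal P :: ('n::finite, 'k::field) mpoly set) \<subseteq> monomial_ideal Q \<longleftrightarrow> (\<forall>m. P m \<longrightarrow> Q m)"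
proof
  assume sub: "(monomial_ideal P :: ('n, 'k) mpoly set) \<subseteq> monomial_ideal Q"
  show "\<forall>m. P m \<longrightarrow> Q m"
  proof (intro allI impI)
    fix m assume "P m"
    then have "(single m 1 :: ('n, 'k) mpoly) \<in> monomial_ideal P" by (simp add: monomial_ideal_def)
    then have "(single m 1 :: ('n, 'k) mpoly) \<in> monomial_ideal Q" using sub by blast
    then show "Q m" by (simp add: monomial_ideal_def)
  qed
qed (auto simp: monomial_ideal_def)

lemma monomial_ideal_eq_iff:
  "(monomial_ideal P :: ('n::finite, 'k::field) mpoly set) = monomial_ideal Q \<longleftrightarrow> P = Q"
  using monomial_ideal_subset_iff[where ?'n = 'n and ?'k = 'k, of P Q]
    monomial_ideal_subset_iff[where ?'n = 'n and ?'k = 'k, of Q P] by auto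

definition divisible_by :: "'n::finite exps set \<Rightarrow> 'n exps \<Rightarrow> bool" where
  "divisible_by S m \<longleftrightarrow> (\<exists>s\<in>S. \<exists>q. m = s + q)"

lemma divisible_by_add:
  assumes "divisible_by S m" shows "divisible_by S (m + q)"
proof -
  obtain s p where "s \<in> S" "m = s + p" using assms unfolding divisible_by_def by blast
  then show ?thesis unfolding divisible_by_def by (intro bexI[of _ s] exI[of _ "p + q"]) (simp_all add: add.assoc)
qed

lemma Idl_power_products:
  "Idl\<^bsub>poly_ring\<^esub> (power_product ` S) = (monomial_ideal (divisible_by S) :: ('n::finite, 'k::field) mpoly set)"
proof -
  interpret ring "poly_ring :: ('n, 'k) mpoly ring" by (rule ring_from_type_algebra)
  have "f \<in> Idl\<^bsub>poly_ring\<^esub> (power_product ` S)" if f: "f \<in> monomial_ideal (divisible_by S)" for f :: "('n, 'k) mpoly"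
  proof (rule poly_mapping_induct_single)
    have id: "ideal (Idl\<^bsub>poly_ring\<^esub> (power_product ` S :: ('n, 'k) mpoly set)) poly_ring"
      by (rule genideal_ideal) simp
    show "0 \<in> Idl\<^bsub>poly_ring\<^esub> (power_product ` S :: ('n, 'k) mpoly set)" by (rule poly_idealD[OF id])
    show "g + h \<in> Idl\<^bsub>poly_ring\<^esub> (power_product ` S)"
      if "g \<in> Idl\<^bsub>poly_ring\<^esub> (power_product ` S)" "h \<in> Idl\<^bsub>poly_ring\<^esub> (power_product ` S)"
      for g h :: "('n, 'k) mpoly" using that by (rule poly_idealD[OF id])
    fix m assume "m \<in> keys f"
    then obtain s q where s: "s \<in> S" "m = s + q" using f by (auto simp: monomial_ideal_def divisible_by_def)
    have "power_product s \<in> Idl\<^bsub>poly_ring\<^esub> (power_product ` S :: ('n, 'k) mpoly set)"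
      using s(1) genideal_self[of "power_product ` S :: ('n, 'k) mpoly set"] by auto
    from poly_idealD(3)[OF id this, of "single q (lookup f m)"]
    show "single m (lookup f m) \<in> Idl\<^bsub>poly_ring\<^esub> (power_product ` S)"
      by (simp add: power_product_def mult_single s(2) add.commute)
  qed
  moreover have "Idl\<^bsub>poly_ring\<^esub> (power_product ` S) \<subseteq> (monomial_ideal (divisible_by S) :: ('n, 'k) mpoly set)"
  proof (rule genideal_minimal)
    show "ideal (monomial_ideal (divisible_by S) :: ('n, 'k) mpoly set) poly_ring"
      by (rule ideal_monomial_ideal) (rule divisible_by_add)
    show "power_product ` S \<subseteq> (monomial_ideal (divisible_by S) :: ('n, 'k) mpoly set)"
      by (auto simp: power_product_def monomial_ideal_def divisible_by_def intro!: exI[of _ 0] bexI)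
  qed
  ultimately show ?thesis by blast
qed

text \<open>Divisibility-minimal exponents occur in every monomial generating set, and by descent on
  the degree they already generate. They thus form the unique inclusion-minimal set, which gives the
  \<open>THE\<close> its meaning.\<close>

lemma minimal_monomial_generators_eq:
  fixes S :: "'n::finite exps set"
  shows "minimal_monomial_generators (monomial_ideal (divisible_by S) :: ('n, 'k::field) mpoly set) =
    {m. divisible_by S m \<and> (\<forall>p q. divisible_by S p \<longrightarrow> m = p + q \<longrightarrow> p = m)}" (is "_ = ?T")
proof -
  have gen: "(monomial_ideal (divisible_by S) :: ('n, 'k) mpoly set) = Idl\<^bsub>poly_ring\<^esub> (power_product ` T)
      \<longleftrightarrow> divisible_by S = divisible_by T" for T
    by (simp add: Idl_power_products monomial_ideal_eq_iff)
  have sub: "?T \<subseteq> T" if T: "divisible_by S = divisible_by T" for T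
  proof
    fix m assume m: "m \<in> ?T"
    then obtain t q where tq: "t \<in> T" "m = t + q" unfolding T divisible_by_def by blast
    have "divisible_by S t" unfolding T divisible_by_def using tq(1) by (intro bexI[of _ t] exI[of _ 0]) auto
    then have "t = m" using m tq(2) by blast
    then show "m \<in> T" using tq(1) by simp
  qed
  have "divisible_by ?T m" if "divisible_by S m" for m
    using that
  proof (induction "mdeg m" arbitrary: m rule: less_induct)
    case less
    show ?case
    proof (cases "m \<in> ?T")
      case True
      then show ?thesis unfolding divisible_by_def by (intro bexI[of _ m] exI[of _ 0]) auto
    next
      case False
      then obtain p q where pq: "divisible_by S p" "m = p + q" "p \<noteq> m" using less.prems by blast
      then have "mdeg q \<noteq> 0" by (auto simp: mdeg_eq_0_iff)
      then have "mdeg p < mdeg m" by (simp add: pq(2) mdeg_add)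
      then have "divisible_by ?T p" using less.hyps pq(1) by blast
      then show ?thesis unfolding pq(2) by (rule divisible_by_add)
    qed
  qed
  moreover have "divisible_by S m" if "divisible_by ?T m" for m
    using that divisible_by_add unfolding divisible_by_def[of ?T] by blast
  ultimately have T: "divisible_by S = divisible_by ?T" by blast
  have "minimal_monomial_generating_set (monomial_ideal (divisible_by S) :: ('n, 'k) mpoly set) T \<longleftrightarrow> T = ?T" for T
  proof
    assume min: "minimal_monomial_generating_set (monomial_ideal (divisible_by S) :: ('n, 'k) mpoly set) T"
    then have "divisible_by S = divisible_by T" unfolding minimal_monomial_generating_set_def gen by blast
    then have "?T \<subseteq> T" by (rule sub)
    moreover have "\<not> ?T \<subset> T" using min T unfolding minimal_monomial_generating_set_def gen by blast
    ultimately show "T = ?T" by blast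
  next
    assume eq: "T = ?T"
    show "minimal_monomial_generating_set (monomial_ideal (divisible_by S) :: ('n, 'k) mpoly set) T"
      unfolding minimal_monomial_generating_set_def gen eq using T sub by blast
  qed
  then show ?thesis by (simp add: minimal_monomial_generators_def)
qed

text \<open>The ideal generated by the variables in \<open>A\<close>, described by its
  monomials.\<close>

definition variable_prime :: "'n::finite set \<Rightarrow> ('n, 'k::field) mpoly set" where
  "variable_prime A = monomial_ideal (\<lambda>m. 0 < degree_in A m)"

text \<open>The ideal of exponents with weight at least \<open>k\<close> is the \<open>k\<close>-th
  power of the variable ideal, and this is its being primary. The case \<open>k = 1\<close> yields
  primality; general \<open>k\<close> lets denominators be cancelled.\<close>

lemma low_degree_mult:
  fixes f g :: "('n::finite, 'k::field) mpoly"
  assumes "f \<notin> variable_prime A" "g \<notin> monomial_ideal (\<lambda>m. k \<le> degree_in A m)"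
  shows "f * g \<notin> monomial_ideal (\<lambda>m. k \<le> degree_in A m)"
proof -
  obtain p where p: "p \<in> keys f" "degree_in A p = 0" using assms(1) by (auto simp: variable_prime_def monomial_ideal_def)
  obtain q where q: "q \<in> keys g" "degree_in A q < k" using assms(2) by (auto simp: monomial_ideal_def not_le)
  obtain m where m: "m \<in> keys (f * g)" "degree_in A m \<le> degree_in A p + degree_in A q"
    using degree_in_keys_mult[OF p(1) q(1)] by blast
  then have "\<not> k \<le> degree_in A m" using p(2) q(2) by simp
  then show ?thesis using m(1) unfolding monomial_ideal_def by blast
qed

lemma primeideal_variable_prime: "primeideal (variable_prime A :: ('n::finite, 'k::field) mpoly set) poly_ring"
proof (rule primeidealI)
  show "ideal (variable_prime A :: ('n, 'k) mpoly set) poly_ring"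
    unfolding variable_prime_def by (rule ideal_monomial_ideal) simp
  show "cring (poly_ring :: ('n, 'k) mpoly ring)" by (rule cring_from_type_algebra)
  have "1 \<notin> (variable_prime A :: ('n, 'k) mpoly set)" by (simp add: variable_prime_def monomial_ideal_def)
  then show "carrier poly_ring \<noteq> (variable_prime A :: ('n, 'k) mpoly set)" by auto
  fix f g :: "('n, 'k) mpoly"
  have Suc: "(monomial_ideal (\<lambda>m. Suc 0 \<le> degree_in A m) :: ('n, 'k) mpoly set) = variable_prime A"
    by (simp add: variable_prime_def Suc_le_eq)
  assume "monoid.mult poly_ring f g \<in> variable_prime A"
  then show "f \<in> variable_prime A \<or> g \<in> variable_prime A" using low_degree_mult[of f A g "Suc 0"] by (auto simp: Suc)
qed

lemma variable_prime_subset_iff: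
  "(variable_prime A :: ('n::finite, 'k::field) mpoly set) \<subseteq> variable_prime B \<longleftrightarrow> A \<subseteq> B"
proof -
  have "A \<subseteq> B" if "\<forall>m. 0 < degree_in A m \<longrightarrow> 0 < degree_in B m"
  proof
    fix x assume "x \<in> A"
    then show "x \<in> B" using that[rule_format, of "single x 1"] by (auto simp: degree_in_single split: if_splits)
  qed
  then show ?thesis
    unfolding variable_prime_def monomial_ideal_subset_iff using degree_in_mono[of A B] by (auto intro: less_le_trans)
qed

lemma primeideal_contains_variable:
  fixes Q :: "('n::finite, 'k::field) mpoly set"
  assumes Q: "primeideal Q poly_ring"
  shows "single m 1 \<in> Q \<Longrightarrow> \<exists>x. 0 < lookup m x \<and> single (single x 1) 1 \<in> Q"
proof (induction "mdeg m" arbitrary: m rule: less_induct)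
  case less
  interpret primeideal Q poly_ring by (rule Q)
  have "m \<noteq> 0"
  proof
    assume "m = 0"
    then have "1 \<in> Q" using less.prems by simp
    then show False using one_imp_carrier I_notcarr by simp
  qed
  then obtain x where x: "0 < lookup m x" using poly_mapping_eqI[of m 0] by auto
  define m' where "m' = m - single x 1"
  have m: "m = single x 1 + m'"
    unfolding m'_def by (rule exps_le_imp_add[symmetric]) (use x in \<open>auto simp: lookup_single when_def\<close>)
  have "monoid.mult poly_ring (single (single x 1) 1) (single m' 1) \<in> Q" using less.prems m by (simp add: mult_single)
  then have "single (single x 1) 1 \<in> Q \<or> single m' 1 \<in> Q" by (intro I_prime) auto
  then show ?case
  proof
    assume "single m' 1 \<in> Q"
    moreover have "mdeg m' < mdeg m" unfolding m mdeg_add by (simp add: mdeg_eq degree_in_single)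
    ultimately obtain y where "0 < lookup m' y" "single (single y 1) 1 \<in> Q" using less.hyps by blast
    then show ?thesis unfolding m by (auto simp: lookup_add)
  qed (use x in blast)
qed

lemma ideal_ideal_power:
  fixes I :: "('n::finite, 'k::field) mpoly set"
  assumes "ideal I poly_ring"
  shows "ideal (ideal_power I k) poly_ring"
proof -
  interpret ring "poly_ring :: ('n, 'k) mpoly ring" by (rule ring_from_type_algebra)
  show ?thesis
  proof (induction k)
    case 0
    then show ?case using oneideal by (simp add: ideal_power_def)
  next
    case (Suc k)
    then show ?case using ideal_prod_is_ideal[OF Suc.IH assms] by (simp add: ideal_power_def)
  qed
qed

section \<open>Symbolic powers of square-free monomial ideals\<close>

text \<open>\<open>P\<close> stands for the exponents of all monomials in the ideal. Avoiding a
  chosen generating set keeps covers and minimal generators independent of it.\<close>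

locale squarefree_monomials =
  fixes P :: "'n::finite exps \<Rightarrow> bool"
  assumes squarefree_divisor: "P m \<Longrightarrow> \<exists>s q. P s \<and> squarefree_exps s \<and> m = s + q"
    and upward: "P m \<Longrightarrow> P (m + q)"
begin

text \<open>Vertex covers of the hypergraph whose edges are the supports of the square-free
  generators.\<close>

definition cover :: "'n set \<Rightarrow> bool" where
  "cover A \<longleftrightarrow> (\<forall>m. P m \<longrightarrow> 0 < degree_in A m)"

definition minimal_cover :: "'n set \<Rightarrow> bool" where
  "minimal_cover A \<longleftrightarrow> cover A \<and> (\<forall>B. B \<subset> A \<longrightarrow> \<not> cover B)"

lemma minimal_cover_exists:
  assumes "cover A" shows "\<exists>B\<subseteq>A. minimal_cover B"
proof -
  have "finite A" by simp
  then show ?thesis using assms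
  proof (induction A rule: finite_psubset_induct)
    case (psubset A)
    show ?case
    proof (cases "minimal_cover A")
      case False
      then obtain B where "B \<subset> A" "cover B" using psubset.prems unfolding minimal_cover_def by blast
      then show ?thesis using psubset.IH[of B] by blast
    qed blast
  qed
qed

lemma subset_variable_prime_iff:
  "(monomial_ideal P :: ('n, 'k::field) mpoly set) \<subseteq> variable_prime A \<longleftrightarrow> cover A"
  by (simp add: variable_prime_def monomial_ideal_subset_iff cover_def)

text \<open>The variables lying in \<open>Q\<close> form such a set: a prime containing a monomial
  contains one of its variables.\<close>

lemma prime_contains_cover_prime:
  fixes Q :: "('n, 'k::field) mpoly set"
  assumes Q: "primeideal Q poly_ring" and sub: "monomial_ideal P \<subseteq> Q"
  shows "\<exists>A. cover A \<and> variable_prime A \<subseteq> Q"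
proof -
  define A where "A = {x. (single (single x 1) 1 :: ('n, 'k) mpoly) \<in> Q}"
  have id: "ideal Q poly_ring" using Q by (simp add: primeideal_def)
  have "cover A"
    unfolding cover_def
  proof (intro allI impI)
    fix m assume "P m"
    then have "(single m 1 :: ('n, 'k) mpoly) \<in> Q" using sub by (auto simp: monomial_ideal_def)
    then show "0 < degree_in A m"
      using primeideal_contains_variable[OF Q, of m] by (auto simp: degree_in_pos_iff A_def)
  qed
  moreover have "f \<in> Q" if f: "f \<in> variable_prime A" for f
  proof (rule poly_mapping_induct_single)
    fix m assume "m \<in> keys f"
    then have "0 < degree_in A m" using f by (simp add: variable_prime_def monomial_ideal_def)
    then obtain x where x: "x \<in> A" "0 < lookup m x" by (auto simp: degree_in_pos_iff)
    have m: "single x 1 + (m - single x 1) = m"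
      by (rule exps_le_imp_add) (use x in \<open>auto simp: lookup_single when_def\<close>)
    have "single (m - single x 1) (lookup f m) * single (single x 1) 1 \<in> Q"
      by (rule poly_idealD(3)[OF id]) (use x(1) in \<open>simp add: A_def\<close>)
    then show "single m (lookup f m) \<in> Q" using m by (simp add: mult_single add.commute)
  qed (use poly_idealD[OF id] in blast)+
  ultimately show ?thesis by blast
qed

lemma minimal_primes_eq:
  "minimal_primes (monomial_ideal P :: ('n, 'k::field) mpoly set) = variable_prime ` {A. minimal_cover A}"
proof (rule subset_antisym)
  show "minimal_primes (monomial_ideal P :: ('n, 'k) mpoly set) \<subseteq> variable_prime ` {A. minimal_cover A}"
  proof
    fix Q :: "('n, 'k) mpoly set"
    assume "Q \<in> minimal_primes (monomial_ideal P)"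
    then have Q: "primeideal Q poly_ring" "monomial_ideal P \<subseteq> Q"
      and min: "\<And>Q'. primeideal Q' poly_ring \<Longrightarrow> monomial_ideal P \<subseteq> Q' \<Longrightarrow> Q' \<subseteq> Q \<Longrightarrow> Q' = Q"
      by (simp_all add: minimal_primes_def)
    obtain A where A: "cover A" "variable_prime A \<subseteq> Q" using prime_contains_cover_prime[OF Q] by blast
    obtain B where B: "B \<subseteq> A" "minimal_cover B" using minimal_cover_exists[OF A(1)] by blast
    have "(variable_prime B :: ('n, 'k) mpoly set) \<subseteq> variable_prime A" using B(1) by (simp add: variable_prime_subset_iff)
    then have "variable_prime B = Q"
      using A(2) B(2) by (intro min primeideal_variable_prime) (auto simp: subset_variable_prime_iff minimal_cover_def)
    then show "Q \<in> variable_prime ` {A. minimal_cover A}" using B(2) by blast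
  qed
  have "variable_prime A \<in> minimal_primes (monomial_ideal P :: ('n, 'k) mpoly set)" if A: "minimal_cover A" for A
    unfolding minimal_primes_def
  proof (intro CollectI conjI allI impI primeideal_variable_prime)
    show "(monomial_ideal P :: ('n, 'k) mpoly set) \<subseteq> variable_prime A"
      using A by (simp add: subset_variable_prime_iff minimal_cover_def)
    fix Q :: "('n, 'k) mpoly set"
    assume Q: "primeideal Q poly_ring" "monomial_ideal P \<subseteq> Q" "Q \<subseteq> variable_prime A"
    obtain B where B: "cover B" "variable_prime B \<subseteq> Q" using prime_contains_cover_prime[OF Q(1,2)] by blast
    then have "(variable_prime B :: ('n, 'k) mpoly set) \<subseteq> variable_prime A" using Q(3) by simp
    then have "B \<subseteq> A" by (simp add: variable_prime_subset_iff)
    then have "B = A" using A B(1) by (auto simp: minimal_cover_def)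
    then show "Q = variable_prime A" using B(2) Q(3) by simp
  qed
  then show "variable_prime ` {A. minimal_cover A} \<subseteq> minimal_primes (monomial_ideal P :: ('n, 'k) mpoly set)" by blast
qed

section \<open>Ordinary powers and their localization at a minimal cover\<close>

lemma ideal_power_subset:
  assumes A: "cover A"
  shows "ideal_power (monomial_ideal P :: ('n, 'k::field) mpoly set) k \<subseteq> monomial_ideal (\<lambda>m. k \<le> degree_in A m)"
proof (induction k)
  case 0
  then show ?case by (simp add: monomial_ideal_def)
next
  case (Suc k)
  show ?case
  proof
    fix f :: "('n, 'k) mpoly"
    assume "f \<in> ideal_power (monomial_ideal P) (Suc k)"
    then have "f \<in> ideal_prod poly_ring (ideal_power (monomial_ideal P) k) (monomial_ideal P)"
      by (simp add: ideal_power_def)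
    then show "f \<in> monomial_ideal (\<lambda>m. Suc k \<le> degree_in A m)"
    proof induction
      case (prod i j)
      have "Suc k \<le> degree_in A m" if m: "m \<in> keys (i * j)" for m
      proof -
        obtain p q where pq: "p \<in> keys i" "q \<in> keys j" "m = p + q" using keys_multD[OF m] by blast
        have "k \<le> degree_in A p" using Suc.IH prod(1) pq(1) by (auto simp: monomial_ideal_def)
        moreover have "0 < degree_in A q" using A prod(2) pq(2) by (simp add: cover_def monomial_ideal_def)
        ultimately show ?thesis by (simp add: pq(3))
      qed
      then show ?case by (simp add: monomial_ideal_def)
    next
      case (sum f g)
      then show ?case using keys_add[of f g] by (auto simp: monomial_ideal_def)
    qed
  qed
qed

text \<open>Some monomial of the ideal escapes \<open>A - {x}\<close>, and so does its square-free
  divisor \<open>s\<close>. Hence \<open>s\<close> divides \<open>x\<close> times the product of the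
  variables outside \<open>A\<close>, which drives the computation of the localization.\<close>

lemma minimal_cover_private:
  assumes A: "minimal_cover A" and x: "x \<in> A"
  shows "\<exists>s. P s \<and> squarefree_exps s \<and> degree_in (A - {x}) s = 0"
proof -
  have "\<not> cover (A - {x})" using A x unfolding minimal_cover_def by blast
  then obtain m where m: "P m" "degree_in (A - {x}) m = 0" by (auto simp: cover_def)
  obtain s q where "P s" "squarefree_exps s" "m = s + q" using squarefree_divisor[OF m(1)] by blast
  then show ?thesis using m(2) by auto
qed

text \<open>Locally at a minimal cover \<open>A\<close> the ideal becomes the prime of \<open>A\<close>: each variable of \<open>A\<close>
  times the product of the variables outside \<open>A\<close> lies in the ideal.\<close>

lemma localization_contraction_eq:
  assumes A: "minimal_cover A"
  shows "localization_contraction (variable_prime A) (ideal_power (monomial_ideal P) k) =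
    (monomial_ideal (\<lambda>m. k \<le> degree_in A m) :: ('n, 'k::field) mpoly set)"
proof (rule subset_antisym)
  let ?V = "monomial_ideal (\<lambda>m. k \<le> degree_in A m) :: ('n, 'k) mpoly set"
  have cov: "cover A" using A by (simp add: minimal_cover_def)
  have idV: "ideal ?V poly_ring" by (rule ideal_monomial_ideal) simp
  show "localization_contraction (variable_prime A) (ideal_power (monomial_ideal P) k) \<subseteq> ?V"
  proof
    fix f :: "('n, 'k) mpoly"
    assume "f \<in> localization_contraction (variable_prime A) (ideal_power (monomial_ideal P) k)"
    then obtain a s u where a: "a \<in> ideal_power (monomial_ideal P) k" and s: "s \<notin> variable_prime A"
      and u: "u \<notin> variable_prime A" "u * (f * s - a * 1) = 0"
      by (auto simp: localization_contraction_def loc_eq_def)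
    have "a \<in> ?V" using a ideal_power_subset[OF cov, where ?'k = 'k] by blast
    then have "u * a \<in> ?V" by (rule poly_idealD(3)[OF idV])
    moreover have "u * a = u * (s * f)" using u(2) by (simp add: algebra_simps)
    ultimately have "u * (s * f) \<in> ?V" by simp
    \<comment> \<open>Neither \<open>u\<close> nor \<open>s\<close> lies in the prime, so both
      cancel from a membership in the primary ideal \<open>?V\<close>.\<close>
    then show "f \<in> ?V" using low_degree_mult[OF u(1)] low_degree_mult[OF s] by blast
  qed
  show "?V \<subseteq> localization_contraction (variable_prime A) (ideal_power (monomial_ideal P) k)"
  proof
    fix f assume f: "f \<in> ?V"
    \<comment> \<open>\<open>h j\<close> is the exponent of the \<open>j\<close>-th power of the
      product of the variables outside \<open>A\<close>, a monomial that becomes invertible in the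
      localization.\<close>
    define h :: "nat \<Rightarrow> 'n exps" where "h j = Abs_poly_mapping (\<lambda>y. if y \<in> A then 0 else j)" for j
    have lh: "lookup (h j) y = (if y \<in> A then 0 else j)" for j y by (simp add: h_def)
    have base: "P (single x 1 + h 1)" if x: "x \<in> A" for x
    proof -
      obtain s where s: "P s" "squarefree_exps s" "degree_in (A - {x}) s = 0"
        using minimal_cover_private[OF A x] by blast
      have "s + (single x 1 + h 1 - s) = single x 1 + h 1"
      proof (rule exps_le_imp_add)
        fix y
        have "lookup s y \<le> 1" using s(2) by (simp add: squarefree_exps_def)
        moreover have "y \<in> A \<Longrightarrow> y \<noteq> x \<Longrightarrow> lookup s y = 0" using s(3) by (simp add: degree_in_def)
        ultimately show "lookup s y \<le> lookup (single x 1 + h 1) y"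
          by (auto simp: lookup_add lh lookup_single when_def)
      qed
      then show ?thesis using upward[OF s(1)] by metis
    qed
    \<comment> \<open>Each step pays for one more factor from the ideal with one variable of
      \<open>A\<close> taken from \<open>m\<close> and one copy of \<open>h 1\<close>.\<close>
    have pow: "single (h j + m) c \<in> ideal_power (monomial_ideal P) j" if "j \<le> degree_in A m" for j m and c :: 'k
      using that
    proof (induction j arbitrary: m)
      case 0
      then show ?case by (simp add: ideal_power_def)
    next
      case (Suc j)
      then have "0 < degree_in A m" by simp
      then obtain x where x: "x \<in> A" "0 < lookup m x" by (auto simp: degree_in_pos_iff)
      define m' where "m' = m - single x 1"
      have m: "m = single x 1 + m'"
        unfolding m'_def by (rule exps_le_imp_add[symmetric]) (use x in \<open>auto simp: lookup_single when_def\<close>)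
      have "j \<le> degree_in A m'" using Suc.prems x(1) by (simp add: m degree_in_single)
      then have "single (h j + m') c \<in> ideal_power (monomial_ideal P) j" by (rule Suc.IH)
      moreover have "(single (single x 1 + h 1) 1 :: ('n, 'k) mpoly) \<in> monomial_ideal P"
        using base[OF x(1)] by (simp add: monomial_ideal_def)
      ultimately have "monoid.mult poly_ring (single (h j + m') c) (single (single x 1 + h 1) 1)
          \<in> ideal_prod poly_ring (ideal_power (monomial_ideal P) j) (monomial_ideal P)"
        by (rule ideal_prod.prod)
      moreover have "h j + m' + (single x 1 + h 1) = h (Suc j) + m"
        unfolding m by (rule poly_mapping_eqI) (simp add: lookup_add lh)
      ultimately show ?case by (simp add: mult_single ideal_power_def)
    qed
    have idk: "ideal (ideal_power (monomial_ideal P :: ('n, 'k) mpoly set) k) poly_ring"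
      by (intro ideal_ideal_power ideal_monomial_ideal upward)
    have "f * single (h k) 1 \<in> ideal_power (monomial_ideal P) k"
    proof (rule poly_mapping_induct_single[of "\<lambda>g. g * single (h k) 1 \<in> ideal_power (monomial_ideal P) k"])
      show "0 * single (h k) 1 \<in> ideal_power (monomial_ideal P :: ('n, 'k) mpoly set) k"
        using poly_idealD(1)[OF idk] by simp
      show "(g + g') * single (h k) 1 \<in> ideal_power (monomial_ideal P) k"
        if "g * single (h k) 1 \<in> ideal_power (monomial_ideal P) k"
          "g' * single (h k) 1 \<in> ideal_power (monomial_ideal P) k" for g g' :: "('n, 'k) mpoly"
        unfolding distrib_right using that by (rule poly_idealD(2)[OF idk])
      fix m assume "m \<in> keys f"
      then have "k \<le> degree_in A m" using f by (simp add: monomial_ideal_def)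
      then show "single m (lookup f m) * single (h k) 1 \<in> ideal_power (monomial_ideal P) k"
        using pow[of k m "lookup f m"] by (simp add: mult_single add.commute)
    qed
    moreover have "degree_in A (h k) = 0" by (simp add: degree_in_def lh)
    then have "(single (h k) 1 :: ('n, 'k) mpoly) \<notin> variable_prime A"
      by (simp add: variable_prime_def monomial_ideal_def)
    moreover have "loc_eq (variable_prime A) (f, 1) (f * single (h k) 1, single (h k) 1)"
      unfolding loc_eq_def by (simp add: variable_prime_def monomial_ideal_def exI[of _ 1])
    ultimately show "f \<in> localization_contraction (variable_prime A) (ideal_power (monomial_ideal P) k)"
      unfolding localization_contraction_def by blast
  qed
qed

definition symbolic_exps :: "nat \<Rightarrow> 'n exps \<Rightarrow> bool" where
  "symbolic_exps k m \<longleftrightarrow> (\<forall>A. minimal_cover A \<longrightarrow> k \<le> degree_in A m)"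

lemma symbolic_power_eq:
  "symbolic_power (monomial_ideal P :: ('n, 'k::field) mpoly set) k = monomial_ideal (symbolic_exps k)"
proof -
  have "symbolic_power (monomial_ideal P :: ('n, 'k) mpoly set) k =
      (\<Inter>A\<in>{A. minimal_cover A}. localization_contraction (variable_prime A) (ideal_power (monomial_ideal P) k))"
    by (simp add: symbolic_power_def minimal_primes_eq)
  also have "\<dots> = (\<Inter>A\<in>{A. minimal_cover A}. monomial_ideal (\<lambda>m. k \<le> degree_in A m))"
    by (rule INF_cong) (simp_all add: localization_contraction_eq)
  also have "\<dots> = monomial_ideal (symbolic_exps k)"
    by (auto simp: monomial_ideal_def symbolic_exps_def)
  finally show ?thesis .
qed

section \<open>Minimal generators and the bounds they give\<close>

definition minimal_generator :: "'n exps \<Rightarrow> bool" where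
  "minimal_generator m \<longleftrightarrow> P m \<and> (\<forall>p q. P p \<longrightarrow> m = p + q \<longrightarrow> p = m)"

lemma minimal_generator_squarefree:
  assumes "minimal_generator w" shows "squarefree_exps w"
proof -
  have "P w" using assms by (simp add: minimal_generator_def)
  then obtain s q where s: "P s" "squarefree_exps s" "w = s + q" using squarefree_divisor by blast
  then have "s = w" using assms unfolding minimal_generator_def by blast
  then show ?thesis using s(2) by simp
qed

text \<open>The variables outside \<open>w\<close> together with \<open>x\<close> form a cover: a
  square-free monomial of the ideal missing them would divide \<open>w\<close> without containing
  \<open>x\<close>, against minimality. A minimal cover inside this set must still meet
  \<open>w\<close>, and can do so only in \<open>x\<close>. Both bounds rest on this.\<close>

lemma minimal_generator_private_cover:
  assumes w: "minimal_generator w" and x: "0 < lookup w x"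
  shows "\<exists>A. minimal_cover A \<and> x \<in> A \<and> lookup w x = 1 \<and> (\<forall>y\<in>A. y \<noteq> x \<longrightarrow> lookup w y = 0)"
proof -
  define B where "B = insert x {y. lookup w y = 0}"
  have sq: "lookup w y \<le> 1" for y using minimal_generator_squarefree[OF w] by (simp add: squarefree_exps_def)
  have Pw: "P w" using w by (simp add: minimal_generator_def)
  have "cover B"
    unfolding cover_def
  proof (intro allI impI)
    fix m assume "P m"
    then obtain s q where s: "P s" "squarefree_exps s" "m = s + q" using squarefree_divisor by blast
    show "0 < degree_in B m"
    proof (rule ccontr)
      assume "\<not> 0 < degree_in B m"
      then have s0: "degree_in B s = 0" by (simp add: s(3))
      then have zero: "lookup s y = 0" if "y \<in> B" for y using that by (simp add: degree_in_def)
      have "s + (w - s) = w"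
      proof (rule exps_le_imp_add)
        fix y
        show "lookup s y \<le> lookup w y"
        proof (cases "y \<in> B")
          case False
          then have "0 < lookup w y" by (simp add: B_def)
          moreover have "lookup s y \<le> 1" using s(2) by (simp add: squarefree_exps_def)
          ultimately show ?thesis by linarith
        qed (simp add: zero)
      qed
      then have "s = w" using w s(1) unfolding minimal_generator_def by metis
      then show False using zero[of x] x by (simp add: B_def)
    qed
  qed
  then obtain A where A: "A \<subseteq> B" "minimal_cover A" using minimal_cover_exists by blast
  have "0 < degree_in A w" using A(2) Pw by (simp add: minimal_cover_def cover_def)
  then obtain y where "y \<in> A" "0 < lookup w y" by (auto simp: degree_in_pos_iff)
  moreover from this have "y = x" using A(1) by (auto simp: B_def)
  ultimately have "x \<in> A" by simp
  moreover have "lookup w x = 1" using sq[of x] x by linarith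
  moreover have "\<forall>y\<in>A. y \<noteq> x \<longrightarrow> lookup w y = 0" using A(1) by (auto simp: B_def)
  ultimately show ?thesis using A(2) by blast
qed

lemma degree_in_le: "(\<And>x. x \<in> A \<Longrightarrow> lookup p x \<le> lookup q x) \<Longrightarrow> degree_in A p \<le> degree_in A q"
  unfolding degree_in_def by (rule sum_mono)

definition scale_exps :: "nat \<Rightarrow> 'n exps \<Rightarrow> 'n exps" where
  "scale_exps k m = Abs_poly_mapping (\<lambda>x. k * lookup m x)"

lemma lookup_scale_exps [simp]: "lookup (scale_exps k m) x = k * lookup m x"
  by (simp add: scale_exps_def)

lemma degree_in_scale_exps: "degree_in A (scale_exps k m) = k * degree_in A m"
  by (simp add: degree_in_def sum_distrib_left)

text \<open>The witness is \<open>w\<^sup>k / x\<close> times the product of the variables outside a minimal cover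
  that meets the support of \<open>w\<close> only in \<open>x\<close>.\<close>

lemma v_number_le:
  assumes w: "minimal_generator w" "w \<noteq> 0" and k: "0 < k"
  shows "v_number (monomial_ideal (symbolic_exps k) :: ('n, 'k::field) mpoly set) \<le> k * mdeg w + card (UNIV :: 'n set)"
proof -
  define J where "J = (monomial_ideal (symbolic_exps k) :: ('n, 'k) mpoly set)"
  obtain x where "0 < lookup w x" using w(2) poly_mapping_eqI[of w 0] by auto
  then obtain A where A: "minimal_cover A" and x: "x \<in> A" "lookup w x = 1"
    and wA: "\<And>y. y \<in> A \<Longrightarrow> y \<noteq> x \<Longrightarrow> lookup w y = 0"
    using minimal_generator_private_cover[OF w(1)] by blast
  \<comment> \<open>On \<open>A\<close> only \<open>x\<close> contributes, with
    \<open>k - 1\<close>, so the cover \<open>A\<close> falls short of \<open>k\<close> by exactly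
    one.\<close>
  define g where "g = Abs_poly_mapping (\<lambda>y. if y = x then k - 1 else k * lookup w y + (if y \<in> A then 0 else 1))"
  have g: "lookup g y = (if y = x then k - 1 else k * lookup w y + (if y \<in> A then 0 else 1))" for y
    by (simp add: g_def)
  have gA: "degree_in A g = k - 1"
  proof -
    have "degree_in A g = (\<Sum>y\<in>A. if y = x then k - 1 else 0)"
      unfolding degree_in_def by (rule sum.cong) (use wA in \<open>auto simp: g\<close>)
    then show ?thesis using x(1) by simp
  qed
  \<comment> \<open>A minimal cover other than \<open>A\<close> contains some \<open>y\<close>
    outside \<open>A\<close>, and the extra factor \<open>y\<close> in \<open>g\<close> compensates
    for the missing \<open>x\<close>.\<close>
  have gB: "k \<le> degree_in B g" if B: "minimal_cover B" "B \<noteq> A" for B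
  proof -
    have "\<not> B \<subset> A" using A B(1) unfolding minimal_cover_def by blast
    then obtain y where y: "y \<in> B" "y \<notin> A" using B(2) by blast
    have "degree_in B (scale_exps k w + single y 1) \<le> degree_in B (g + single x 1)"
      by (rule degree_in_le) (use y x k in \<open>auto simp: lookup_add g lookup_single when_def\<close>)
    then have "k * degree_in B w + 1 \<le> degree_in B g + 1"
      using y(1) by (auto simp: degree_in_scale_exps degree_in_single split: if_splits)
    moreover have "0 < degree_in B w"
      using B(1) w(1) by (simp add: minimal_cover_def cover_def minimal_generator_def)
    then have "k * 1 \<le> k * degree_in B w" by (intro mult_le_mono2) simp
    ultimately show ?thesis by linarith
  qed
  have sym: "symbolic_exps k (g + m) \<longleftrightarrow> 0 < degree_in A m" for m
  proof
    assume "symbolic_exps k (g + m)"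
    then show "0 < degree_in A m" using A gA k by (auto simp: symbolic_exps_def)
  next
    assume m: "0 < degree_in A m"
    show "symbolic_exps k (g + m)"
      unfolding symbolic_exps_def
    proof (intro allI impI)
      fix B assume "minimal_cover B"
      then show "k \<le> degree_in B (g + m)" using gB[of B] gA m by (cases "B = A") auto
    qed
  qed
  have "colon J (single g 1) = variable_prime A"
    by (auto simp: colon_def J_def monomial_ideal_def variable_prime_def keys_single_mult sym mult.commute[of _ "single g 1"])
  moreover have "variable_prime A \<in> associated_primes J"
    unfolding associated_primes_def using primeideal_variable_prime calculation[symmetric] by blast
  moreover have "(single g 1 :: ('n, 'k) mpoly) \<in> graded_component (int (mdeg g))" by (simp add: graded_component_def)
  ultimately have "v_number J \<le> mdeg g" unfolding v_number_def by (intro Least_le) blast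
  \<comment> \<open>At most one extra factor per variable: this is the origin of the summand
    \<open>card UNIV\<close>.\<close>
  also have "mdeg g \<le> (\<Sum>y\<in>UNIV. k * lookup w y + 1)"
    unfolding mdeg_def by (rule sum_mono) (use x(2) in \<open>auto simp: g\<close>)
  also have "\<dots> = k * mdeg w + card (UNIV :: 'n set)"
    unfolding mdeg_def sum.distrib by (simp add: sum_distrib_left)
  finally show ?thesis by (simp add: J_def)
qed

lemma symbolic_exps_upward: "symbolic_exps k m \<Longrightarrow> symbolic_exps k (m + q)"
  by (auto simp: symbolic_exps_def intro: trans_le_add1)

text \<open>Membership survives truncating every exponent at \<open>k\<close>: on a given cover
  either some exponent reaches \<open>k\<close> and suffices alone, or none does and truncation
  changes nothing there. Degrees bounded by \<open>k\<close> in each variable therefore suffice, and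
  the general construction applies.\<close>

lemma symbolic_power_resolution_exists:
  assumes "\<not> symbolic_exps k 0"
  shows "\<exists>F. minimal_free_resolution (monomial_ideal (symbolic_exps k) :: ('n, 'k::field) mpoly set) F"
proof (rule minimal_free_resolution_exists)
  define J where "J = (monomial_ideal (symbolic_exps k) :: ('n, 'k) mpoly set)"
  define N where "N = {v \<in> carrier_vec 1. v $ 0 \<in> J}"
  have id: "ideal J poly_ring" unfolding J_def by (rule ideal_monomial_ideal) (rule symbolic_exps_upward)
  have "vec_submodule 1 N" by (rule vec_submoduleI) (auto simp: N_def intro: poly_idealD[OF id])
  moreover have "component (\<lambda>_. 0) b v \<in> N" if "v \<in> N" for b v
    using that by (auto simp: N_def component_def J_def monomial_ideal_def keys_restrict_keys)
  moreover
  define B :: "'n exps set" where "B = {b. \<forall>x. lookup b x \<le> lookup (Abs_poly_mapping (\<lambda>_. k)) x}"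
  have "finite B" unfolding B_def by (rule finite_exps_le)
  moreover have "reducible_to_degrees 1 (\<lambda>_. 0) N B"
    unfolding reducible_to_degrees_def
  proof (intro allI ballI impI)
    fix b v assume v: "v \<in> N" and hv: "hom_vec 1 (\<lambda>_. 0) b v"
    define b' where "b' = Abs_poly_mapping (\<lambda>x. min (lookup b x) k)"
    have lb': "lookup b' x = min (lookup b x) k" for x by (simp add: b'_def)
    define v' where "v' = vec 1 (\<lambda>_. single b' (lookup (v $ 0) b))"
    have b: "b' + (b - b') = b" by (rule exps_le_imp_add) (simp add: lb')
    have "keys (v $ 0) \<subseteq> {b}" using hv by (auto simp: hom_vec_def)
    then have v0: "v $ 0 = single b (lookup (v $ 0) b)" by (rule keys_subset_singleton)
    have "symbolic_exps k b'" if "lookup (v $ 0) b \<noteq> 0"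
      unfolding symbolic_exps_def
    proof (intro allI impI)
      fix A assume A: "minimal_cover A"
      have "b \<in> keys (v $ 0)" using that by (simp add: in_keys_iff)
      then have "symbolic_exps k b" using v by (simp add: N_def J_def monomial_ideal_def)
      then have kb: "k \<le> degree_in A b" using A by (simp add: symbolic_exps_def)
      show "k \<le> degree_in A b'"
      proof (cases "\<exists>x\<in>A. k \<le> lookup b x")
        case True
        then obtain x where x: "x \<in> A" "k \<le> lookup b x" by blast
        have "lookup b' x \<le> degree_in A b'" unfolding degree_in_def by (rule member_le_sum) (use x in auto)
        then show ?thesis using x(2) by (simp add: lb')
      next
        case False
        have "degree_in A b \<le> degree_in A b'" by (rule degree_in_le) (use False in \<open>auto simp: lb'\<close>)
        then show ?thesis using kb by simp
      qed
    qed
    then have "v' \<in> N" by (simp add: v'_def N_def J_def monomial_ideal_def)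
    moreover have "hom_vec 1 (\<lambda>_. 0) b' v'" by (simp add: hom_vec_def v'_def)
    moreover have "v = single (b - b') 1 \<cdot>\<^sub>v v'"
    proof (rule eq_vecI)
      fix i assume "i < dim_vec (single (b - b') 1 \<cdot>\<^sub>v v')"
      then have "i = 0" by (simp add: v'_def)
      moreover have "b - b' + b' = b" using b by (simp add: add.commute)
      then have "single (b - b') 1 * v' $ 0 = single b (lookup (v $ 0) b)" by (simp add: v'_def mult_single)
      then have "single (b - b') 1 * v' $ 0 = v $ 0" unfolding v0[symmetric] .
      ultimately show "v $ i = (single (b - b') 1 \<cdot>\<^sub>v v') $ i" by (simp add: v'_def)
    qed (use v in \<open>simp add: N_def v'_def\<close>)
    moreover have "b' \<in> B" by (simp add: B_def lb')
    ultimately show "\<exists>b'\<in>B. \<exists>m. \<exists>v'\<in>N. hom_vec 1 (\<lambda>_. 0) b' v' \<and> v = single m 1 \<cdot>\<^sub>v v'" by blast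
  qed
  ultimately show "fine_submodule 1 (\<lambda>_. 0) {v \<in> carrier_vec 1. v $ 0 \<in> (monomial_ideal (symbolic_exps k) :: ('n, 'k) mpoly set)}"
    unfolding fine_submodule_def N_def J_def by blast
  show "(monomial_ideal (symbolic_exps k) :: ('n, 'k) mpoly set) \<subseteq> irrelevant_ideal"
    using assms by (auto simp: monomial_ideal_def irrelevant_ideal_def in_keys_iff)
qed

text \<open>\<open>u\<^sup>k\<close> is a minimal generator of the symbolic power: for every variable \<open>x\<close> of \<open>u\<close> some minimal
  cover meets the support of \<open>u\<close> only in \<open>x\<close>, so that \<open>u\<^sup>k / x\<close> has degree \<open>k - 1\<close> on it.\<close>

lemma regularity_symbolic_power_ge:
  assumes u: "minimal_generator u" "u \<noteq> 0" and k: "0 < k"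
  shows "int (k * mdeg u) - 1 \<le> regularity_quotient (monomial_ideal (symbolic_exps k) :: ('n, 'k::field) mpoly set)"
proof -
  obtain x where "0 < lookup u x" using u(2) poly_mapping_eqI[of u 0] by auto
  then obtain A where "minimal_cover A" using minimal_generator_private_cover[OF u(1)] by blast
  then have proper: "\<not> symbolic_exps k 0" using k by (auto simp: symbolic_exps_def)
  have mem: "symbolic_exps k (scale_exps k u)"
    unfolding symbolic_exps_def
  proof (intro allI impI)
    fix A assume "minimal_cover A"
    then have "0 < degree_in A u" using u(1) by (simp add: minimal_cover_def cover_def minimal_generator_def)
    then have "k * 1 \<le> k * degree_in A u" by (intro mult_le_mono2) simp
    then show "k \<le> degree_in A (scale_exps k u)" by (simp add: degree_in_scale_exps)
  qed
  have min: "m = scale_exps k u" if m: "symbolic_exps k m" and eq: "scale_exps k u = m + q" for m q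
  proof (rule ccontr)
    assume "m \<noteq> scale_exps k u"
    then have "q \<noteq> 0" using eq by auto
    then obtain x where x: "0 < lookup q x" using poly_mapping_eqI[of q 0] by auto
    have "lookup (scale_exps k u) x = lookup m x + lookup q x" by (simp only: eq lookup_add)
    then have "0 < lookup u x" using x by (cases "lookup u x") auto
    then obtain A where A: "minimal_cover A" "x \<in> A" "lookup u x = 1" "\<And>y. y \<in> A \<Longrightarrow> y \<noteq> x \<Longrightarrow> lookup u y = 0"
      using minimal_generator_private_cover[OF u(1)] by blast
    have "degree_in A u = (\<Sum>y\<in>A. if y = x then 1 else 0)"
      unfolding degree_in_def by (rule sum.cong) (use A in auto)
    then have "degree_in A (scale_exps k u) = k" using A(2) by (simp add: degree_in_scale_exps)
    then have "degree_in A m + degree_in A q = k" by (simp add: eq)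
    moreover have "0 < degree_in A q" using x A(2) by (auto simp: degree_in_pos_iff)
    moreover have "k \<le> degree_in A m" using m A(1) by (simp add: symbolic_exps_def)
    ultimately show False by simp
  qed
  have "int (mdeg (scale_exps k u)) - 1 \<le> regularity_quotient (monomial_ideal (symbolic_exps k) :: ('n, 'k) mpoly set)"
    by (rule regularity_quotient_ge[OF symbolic_power_resolution_exists[OF proper] proper mem]) (rule min)
  then show ?thesis by (simp add: mdeg_eq degree_in_scale_exps)
qed

end

theorem corollary4p2:
  fixes I :: "('n::finite, 'k::field) mpoly set"
  assumes "squarefree_monomial_ideal I"
    and "non_equigenerated I"
  shows "\<forall>\<^sub>F k in sequentially.
    int (v_number (symbolic_power I k)) \<le> regularity_quotient (symbolic_power I k)"
proof -
  obtain S where S: "\<And>m. m \<in> S \<Longrightarrow> squarefree_exps m" and I: "I = monomial_ideal (divisible_by S)"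
    using assms(1) unfolding squarefree_monomial_ideal_def Idl_power_products by blast
  interpret squarefree_monomials "divisible_by S"
  proof
    fix m q assume m: "divisible_by S m"
    show "divisible_by S (m + q)" by (rule divisible_by_add[OF m])
    obtain s p where s: "s \<in> S" "m = s + p" using m unfolding divisible_by_def by blast
    have "divisible_by S s" unfolding divisible_by_def by (intro bexI[of _ s] exI[of _ 0]) (use s in auto)
    then show "\<exists>s q. divisible_by S s \<and> squarefree_exps s \<and> m = s + q" using s S by blast
  qed
  have gens: "minimal_monomial_generators I = {m. minimal_generator m}"
    unfolding I minimal_monomial_generators_eq minimal_generator_def ..
  obtain u w where u: "minimal_generator u" and w: "minimal_generator w" and less: "mdeg w < mdeg u"
    using assms(2) unfolding non_equigenerated_def gens by (metis linorder_neqE_nat mem_Collect_eq)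
  have u0: "u \<noteq> 0" using less by auto
  \<comment> \<open>If 1 were a minimal generator it would divide \<open>u\<close> and, by
    minimality of \<open>u\<close>, equal it.\<close>
  have w0: "w \<noteq> 0"
  proof
    assume "w = 0"
    then have "w = u" using u w unfolding minimal_generator_def by (metis add_0)
    then show False using less by simp
  qed
  show ?thesis
  \<comment> \<open>The degree gap contributes at least \<open>k\<close>, which has to absorb
    \<open>n\<close> from the v-number bound and \<open>1\<close> from the regularity bound.\<close>
  proof (rule eventually_sequentiallyI[of "card (UNIV :: 'n set) + 1"])
    fix k assume k: "card (UNIV :: 'n set) + 1 \<le> k"
    have "k * (mdeg w + 1) \<le> k * mdeg u" using less by (intro mult_le_mono2) simp
    then have "k * mdeg w + card (UNIV :: 'n set) + 1 \<le> k * mdeg u" using k by simp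
    moreover have "v_number (symbolic_power I k) \<le> k * mdeg w + card (UNIV :: 'n set)"
      unfolding I symbolic_power_eq using k by (intro v_number_le[OF w w0]) simp
    moreover have "int (k * mdeg u) - 1 \<le> regularity_quotient (symbolic_power I k)"
      unfolding I symbolic_power_eq using k by (intro regularity_symbolic_power_ge[OF u u0]) simp
    ultimately show "int (v_number (symbolic_power I k)) \<le> regularity_quotient (symbolic_power I k)" by linarith
  qed
qed

end
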